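(* Let $k\ge 2$ and a set $R_k=\{c_1,\dots,c_k\}\subset\mathbb{R}$ of $k$ distinct real numbers be fixed. For each $n$, let $n_1\ge n_2\ge\cdots\ge n_k$ be positive integers (depending on $n$) with $\sum_{i=1}^k n_i=n$, and assume that there is a constant $c>0$ such that $n_k\ge cn$ for all $n$. Let $y\in\Omega_{n_1,\dots,n_k}$ (the true color assignment function), let $\sigma\in\mathbb{R}$ be deterministic (possibly depending on $n$), and let the observation be $$\mathbf{R}=\mathbf{K}(y)+\sigma\mathbf{W},$$ where $\mathbf{W}$ is a random $n\times n$ matrix with i.i.d. standard (real) Gaussian entries. Let $$\tilde{y}=\mathrm{argmin}_{x\in\Omega_{\frac{2c}{3}}}\|\mathbf{R}-\mathbf{K}(x)\|_F^2,\qquad \overline{y}=\mathrm{argmin}_{x\in\Omega_{n_1,\dots,n_k}}\|\mathbf{R}-\mathbf{K}(x)\|_F^2 .$$ Then: (1) If there exists a constant $\delta>0$ such that $$\sigma^2<\frac{(1-\delta)(n_k+n_{k-1})}{4\log n},$$ then $\lim_{n\to\infty}\Pr(\tilde{y}\in C(y))=1$ and $\lim_{n\to\infty}\Pr(\overline{y}\in C(y))=1$. (2) If there exists a constant $\delta>0$ such that $$\sigma^2>\frac{(1+\delta)(n_k+n_{k-1})}{4\log n},$$ then $\lim_{n\to\infty}\Pr(\tilde{y}\in C(y))=0$ and $\lim_{n\to\infty}\Pr(\overline{y}\in C(y))=0$.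
   Context: $[n]=\{1,\dots,n\}$. $\Omega$ is the set of all mappings $x:[n]\to R_k$ (color assignment mappings). $\Omega_{n_1,\dots,n_k}=\{x\in\Omega : |x^{-1}(c_i)|=n_i\ \text{for all }1\le i\le k\}$. For a real number $a>0$, $\Omega_a=\{x\in\Omega:\min_{1\le j\le k}|x^{-1}(c_j)|\ge an\}$; thus $\Omega_{\frac{2c}{3}}$ requires every color to be used at least $\frac{2c}{3}n$ times. For $x\in\Omega$, $\mathbf{K}(x)$ is the $n\times n$ matrix with $\mathbf{K}_{i,j}(x)=1$ if $x(i)\ne x(j)$ and $\mathbf{K}_{i,j}(x)=0$ if $x(i)=x(j)$. For $x,y\in\Omega$, $x$ and $y$ are equivalent, written $x\in C(y)$, if for all $i,j\in[n]$: $x(i)=x(j)$ if and only if $y(i)=y(j)$. Since $\mathbf{K}(x)$ depends only on the equivalence class of $x$, the minimizers $\tilde y,\overline y$ are determined only up to equivalence. $\|\cdot\|_F$ is the Frobenius norm. *)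

theory Defs
  imports "HOL-Probability.Probability"
begin

text \<open>
  Vertices are \<open>1, \<dots>, n\<close>. The palette is \<open>R\<^sub>k = {col 1, \<dots>, col k}\<close> for a function \<open>col\<close> that is
  injective on \<open>{1..k}\<close>. Since the dimension \<open>n\<close> tends to infinity, \<open>n \<times> n\<close> matrices are functions
  \<open>nat \<Rightarrow> nat \<Rightarrow> real\<close> of which only the entries with indices in \<open>{1..n}\<close> matter.
\<close>

definition palette :: "(nat \<Rightarrow> real) \<Rightarrow> nat \<Rightarrow> real set" where
  "palette col k = col ` {1..k}"

text \<open>The extensional function space makes two assignments equal iff they agree on \<open>{1..n}\<close>.\<close>

definition assignments :: "(nat \<Rightarrow> real) \<Rightarrow> nat \<Rightarrow> nat \<Rightarrow> (nat \<Rightarrow> real) set" where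
  "assignments col k n = {1..n} \<rightarrow>\<^sub>E palette col k"

definition color_count :: "nat \<Rightarrow> (nat \<Rightarrow> real) \<Rightarrow> real \<Rightarrow> nat" where
  "color_count n x a = card (x -` {a} \<inter> {1..n})"

definition assignments_with_sizes ::
    "(nat \<Rightarrow> real) \<Rightarrow> nat \<Rightarrow> nat \<Rightarrow> (nat \<Rightarrow> nat) \<Rightarrow> (nat \<Rightarrow> real) set" where
  "assignments_with_sizes col k n s =
     {x \<in> assignments col k n. \<forall>i\<in>{1..k}. color_count n x (col i) = s i}"

definition assignments_min_fraction ::
    "(nat \<Rightarrow> real) \<Rightarrow> nat \<Rightarrow> nat \<Rightarrow> real \<Rightarrow> (nat \<Rightarrow> real) set" where
  "assignments_min_fraction col k n a =
     {x \<in> assignments col k n. real (MIN j\<in>{1..k}. color_count n x (col j)) \<ge> a * real n}"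

definition K_mat :: "(nat \<Rightarrow> real) \<Rightarrow> nat \<Rightarrow> nat \<Rightarrow> real" where
  "K_mat x i j = (if x i \<noteq> x j then 1 else 0)"

definition equiv_class :: "(nat \<Rightarrow> real) \<Rightarrow> nat \<Rightarrow> nat \<Rightarrow> (nat \<Rightarrow> real) \<Rightarrow> (nat \<Rightarrow> real) set" where
  "equiv_class col k n y =
     {x \<in> assignments col k n. \<forall>i\<in>{1..n}. \<forall>j\<in>{1..n}. x i = x j \<longleftrightarrow> y i = y j}"

definition frobenius_norm :: "nat \<Rightarrow> (nat \<Rightarrow> nat \<Rightarrow> real) \<Rightarrow> real" where
  "frobenius_norm n A = sqrt (\<Sum>i\<in>{1..n}. \<Sum>j\<in>{1..n}. (A i j)\<^sup>2)"

definition std_gaussian_matrix :: "'w measure \<Rightarrow> nat \<Rightarrow> (nat \<Rightarrow> nat \<Rightarrow> 'w \<Rightarrow> real) \<Rightarrow> bool" where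
  "std_gaussian_matrix M n W \<longleftrightarrow>
     prob_space.indep_vars M (\<lambda>_. borel) (\<lambda>(i, j). W i j) ({1..n} \<times> {1..n}) \<and>
     (\<forall>i\<in>{1..n}. \<forall>j\<in>{1..n}. distributed M lborel (W i j) std_normal_density)"

definition observation ::
    "(nat \<Rightarrow> real) \<Rightarrow> real \<Rightarrow> (nat \<Rightarrow> nat \<Rightarrow> 'w \<Rightarrow> real) \<Rightarrow> 'w \<Rightarrow> nat \<Rightarrow> nat \<Rightarrow> real" where
  "observation y \<sigma> W \<omega> i j = K_mat y i j + \<sigma> * W i j \<omega>"

text \<open>
  A minimizer over a set \<open>S\<close> of assignments is in general not unique, as the objective depends on
  \<open>x\<close> only through its equivalence class. An estimator is therefore any random variable that
  selects a minimizer; measurability is required so that its events have probabilities.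
\<close>

definition is_least_squares_estimator ::
    "'w measure \<Rightarrow> nat \<Rightarrow> ('w \<Rightarrow> nat \<Rightarrow> nat \<Rightarrow> real) \<Rightarrow> (nat \<Rightarrow> real) set \<Rightarrow>
     ('w \<Rightarrow> nat \<Rightarrow> real) \<Rightarrow> bool" where
  "is_least_squares_estimator M n R S z \<longleftrightarrow>
     z \<in> measurable M (count_space S) \<and>
     (\<forall>\<omega>\<in>space M.
        is_arg_min (\<lambda>x. (frobenius_norm n (\<lambda>i j. R \<omega> i j - K_mat x i j))\<^sup>2) (\<lambda>x. x \<in> S) (z \<omega>))"

end

theory Submission
  imports Defs "HOL-Real_Asymp.Real_Asymp"
begin

text \<open>
  For an assignment \<open>x\<close> let \<open>D\<close> be the set of ordered pairs at which \<open>K_mat x\<close> and \<open>K_mat y\<close> differ.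
  The objective at \<open>x\<close> exceeds the one at \<open>y\<close> by \<open>|D| - 2 |\<sigma>| G\<close>, where \<open>G\<close> is a centred Gaussian
  of variance \<open>|D|\<close>, so \<open>x\<close> beats \<open>y\<close> with probability at most \<open>exp (- |D| / (8 \<sigma>\<^sup>2))\<close>.
  Write \<open>S\<close> for the sum of the two smallest class sizes.

  Below the threshold, a union bound over all inequivalent assignments suffices. If \<open>x\<close> moves \<open>m\<close>
  vertices, then \<open>|D| \<ge> 2 m (S - m)\<close>, which beats the entropy \<open>(n k) ^ m\<close> when \<open>m\<close> is a small
  multiple of \<open>n\<close>; an assignment not equivalent to such an \<open>x\<close> has \<open>|D|\<close> of order
  \<open>n\<^sup>2\<close>, because otherwise the dominant colors of \<open>x\<close> on the classes of \<open>y\<close> would define a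
  permutation of the palette.

  Above the threshold, swapping two vertices of the two smallest classes keeps the class sizes, so both
  estimators compete with all swaps. Among linearly many swapped vertices on either side the
  gains are nearly independent Gaussians, and the largest of them exceeds the cost of the swap.
\<close>

section \<open>Sums of independent standard normal variables\<close>

text \<open>For \<open>x \<ge> t \<ge> 0\<close> one has \<open>t * x \<ge> t * t\<close>, so
  \<open>x\<^sup>2\<close> is at least \<open>t\<^sup>2 + (x - t)\<^sup>2\<close>. Hence the density
  is dominated on the half-line by \<open>exp (- t\<^sup>2 / 2)\<close> times the normal density
  centred at \<open>t\<close>, whose total mass is 1.\<close>

lemma std_normal_upper_tail:
  assumes "t \<ge> 0"
  shows "emeasure (density lborel std_normal_density) {t..} \<le> ennreal (exp (- t\<^sup>2 / 2))"
proof -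
  have pt: "ennreal (std_normal_density x) * indicator {t..} x
      \<le> ennreal (exp (- t\<^sup>2 / 2)) * ennreal (normal_density t 1 x)" for x
  proof (cases "t \<le> x")
    case True
    have "t * t \<le> t * x" using True assms by (rule mult_left_mono)
    then have "- x\<^sup>2 / 2 \<le> - t\<^sup>2 / 2 + (- (x - t)\<^sup>2 / 2)"
      by (simp add: power2_eq_square algebra_simps)
    then have "exp (- x\<^sup>2 / 2) \<le> exp (- t\<^sup>2 / 2) * exp (- (x - t)\<^sup>2 / 2)"
      by (simp flip: exp_add)
    then have "std_normal_density x \<le> exp (- t\<^sup>2 / 2) * normal_density t 1 x"
      by (simp add: normal_density_def divide_right_mono)
    then show ?thesis using True
      by (simp add: ennreal_mult[symmetric])
  qed simp
  have "emeasure (density lborel std_normal_density) {t..}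
      = (\<integral>\<^sup>+x. ennreal (std_normal_density x) * indicator {t..} x \<partial>lborel)"
    by (simp add: emeasure_density)
  also have "\<dots> \<le> (\<integral>\<^sup>+x. ennreal (exp (- t\<^sup>2 / 2)) * ennreal (normal_density t 1 x) \<partial>lborel)"
    by (intro nn_integral_mono pt)
  also have "\<dots> = ennreal (exp (- t\<^sup>2 / 2)) * (\<integral>\<^sup>+x. ennreal (normal_density t 1 x) \<partial>lborel)"
    by (simp add: nn_integral_cmult)
  also have "(\<integral>\<^sup>+x. ennreal (normal_density t 1 x) \<partial>lborel) = 1"
    by (subst nn_integral_eq_integral) auto
  finally show ?thesis by simp
qed

text \<open>Only the mass of the unit interval above \<open>t\<close> is kept, where the density is
  smallest at the right end \<open>t + 1\<close>. The loss is subpolynomial in \<open>n\<close> when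
  \<open>t\<close> is of order \<open>sqrt (ln n)\<close>.\<close>

lemma std_normal_lower_tail:
  assumes "t \<ge> 0"
  shows "emeasure (density lborel std_normal_density) {t..}
           \<ge> ennreal (exp (- (t + 1)\<^sup>2 / 2) / sqrt (2 * pi))"
proof -
  let ?c = "exp (- (t + 1)\<^sup>2 / 2) / sqrt (2 * pi)"
  have pt: "ennreal ?c * indicator {t..t+1} x \<le> ennreal (std_normal_density x) * indicator {t..} x" for x
  proof (cases "x \<in> {t..t+1}")
    case True
    then have "x\<^sup>2 \<le> (t+1)\<^sup>2" using assms by (intro power_mono) auto
    then have "?c \<le> std_normal_density x"
      by (simp add: normal_density_def divide_right_mono)
    then show ?thesis using True by simp
  qed simp
  have "ennreal ?c = (\<integral>\<^sup>+x. ennreal ?c * indicator {t..t+1} x \<partial>lborel)"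
    by (subst nn_integral_cmult_indicator) auto
  also have "\<dots> \<le> (\<integral>\<^sup>+x. ennreal (std_normal_density x) * indicator {t..} x \<partial>lborel)"
    by (intro nn_integral_mono pt)
  also have "\<dots> = emeasure (density lborel std_normal_density) {t..}"
    by (simp add: emeasure_density)
  finally show ?thesis .
qed

text \<open>In the applications the index set consists of matrix positions and \<open>X\<close> of
  the entries of \<open>W\<close>, up to deterministic signs.\<close>

locale iid_std_normal = prob_space M for M :: "'a measure" +
  fixes X :: "'i \<Rightarrow> 'a \<Rightarrow> real" and I :: "'i set"
  assumes indep: "indep_vars (\<lambda>_. borel) X I"
    and finite_index: "finite I"
    and distr: "i \<in> I \<Longrightarrow> distributed M lborel (X i) std_normal_density"
begin

lemma sum_measurable:
  assumes "J \<subseteq> I"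
  shows "(\<lambda>\<omega>. \<Sum>i\<in>J. X i \<omega>) \<in> borel_measurable M"
proof -
  have "X i \<in> borel_measurable M" if "i \<in> J" for i
    using indep that assms by (auto simp: indep_vars_def)
  then show ?thesis by measurable
qed

lemma emeasure_sum_ge:
  assumes J: "J \<subseteq> I" "J \<noteq> {}"
  shows "emeasure M {\<omega> \<in> space M. (\<Sum>i\<in>J. X i \<omega>) \<ge> t}
           = emeasure (density lborel std_normal_density) {t / sqrt (card J)..}"
proof -
  have fin: "finite J" using J finite_index finite_subset by blast
  have pos: "sqrt (card J) > 0" using fin J by (simp add: card_gt_0_iff)
  have "distributed M lborel (\<lambda>\<omega>. \<Sum>i\<in>J. X i \<omega>) (normal_density (\<Sum>i\<in>J. 0) (sqrt (\<Sum>i\<in>J. 1\<^sup>2)))"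
    using J fin distr by (intro sum_indep_normal indep_vars_subset[OF indep]) auto
  then have "distributed M lborel (\<lambda>\<omega>. \<Sum>i\<in>J. X i \<omega>) (normal_density 0 (sqrt (card J)))"
    by simp
  then have D: "distributed M lborel (\<lambda>\<omega>. ((\<Sum>i\<in>J. X i \<omega>) - 0) / sqrt (card J)) std_normal_density"
    using normal_standard_normal_convert[OF pos, of "\<lambda>\<omega>. \<Sum>i\<in>J. X i \<omega>" 0] by simp
  have "{\<omega> \<in> space M. (\<Sum>i\<in>J. X i \<omega>) \<ge> t}
      = (\<lambda>\<omega>. ((\<Sum>i\<in>J. X i \<omega>) - 0) / sqrt (card J)) -` {t / sqrt (card J)..} \<inter> space M"
    using pos by (auto simp: divide_le_cancel)
  then show ?thesis
    using distributed_emeasure[OF D, of "{t / sqrt (card J)..}"]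
    by (simp add: emeasure_density)
qed

lemma prob_sum_ge_upper:
  assumes J: "J \<subseteq> I" "J \<noteq> {}" and "t \<ge> 0"
  shows "prob {\<omega> \<in> space M. (\<Sum>i\<in>J. X i \<omega>) \<ge> t} \<le> exp (- t\<^sup>2 / (2 * card J))"
proof -
  have "ennreal (prob {\<omega> \<in> space M. (\<Sum>i\<in>J. X i \<omega>) \<ge> t}) \<le> ennreal (exp (- (t / sqrt (card J))\<^sup>2 / 2))"
    unfolding emeasure_eq_measure[symmetric] emeasure_sum_ge[OF J]
    by (rule std_normal_upper_tail) (simp add: assms)
  then have "prob {\<omega> \<in> space M. (\<Sum>i\<in>J. X i \<omega>) \<ge> t} \<le> exp (- (t / sqrt (card J))\<^sup>2 / 2)"
    by simp
  then show ?thesis by (simp add: power_divide mult.commute)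
qed

lemma prob_sum_ge_lower:
  assumes J: "J \<subseteq> I" "J \<noteq> {}" and "t \<ge> 0"
  shows "prob {\<omega> \<in> space M. (\<Sum>i\<in>J. X i \<omega>) \<ge> t}
           \<ge> exp (- (t / sqrt (card J) + 1)\<^sup>2 / 2) / sqrt (2 * pi)"
proof -
  have "ennreal (prob {\<omega> \<in> space M. (\<Sum>i\<in>J. X i \<omega>) \<ge> t})
      \<ge> ennreal (exp (- (t / sqrt (card J) + 1)\<^sup>2 / 2) / sqrt (2 * pi))"
    unfolding emeasure_eq_measure[symmetric] emeasure_sum_ge[OF J]
    by (rule std_normal_lower_tail) (simp add: assms)
  then show ?thesis by simp
qed

text \<open>The standard normal law is symmetric, so deterministic signs can be absorbed into the
  noise. This disposes of the signs in \<open>ls_objective_diff\<close> and turns upper tails into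
  lower tails.\<close>

lemma scale_unit: "iid_std_normal M (\<lambda>i \<omega>. g i * X i \<omega>) I" if "\<And>i. i \<in> I \<Longrightarrow> \<bar>g i\<bar> = (1::real)"
proof
  have "indep_vars (\<lambda>_. borel) (\<lambda>i \<omega>. (\<lambda>x. g i * x) (X i \<omega>)) I"
    by (rule indep_vars_compose2[OF indep]) simp
  then show "indep_vars (\<lambda>_. borel) (\<lambda>i \<omega>. g i * X i \<omega>) I" by simp
  show "finite I" by (rule finite_index)
  show "distributed M lborel (\<lambda>\<omega>. g i * X i \<omega>) std_normal_density" if "i \<in> I" for i
    using normal_density_affine[OF distr[OF that], of "g i" 0] \<open>i \<in> I\<close> \<open>\<And>i. i \<in> I \<Longrightarrow> \<bar>g i\<bar> = 1\<close>[of i]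
    by auto
qed

lemma prob_sum_le_upper:
  assumes J: "J \<subseteq> I" "J \<noteq> {}" and "t \<ge> 0"
  shows "prob {\<omega> \<in> space M. (\<Sum>i\<in>J. X i \<omega>) \<le> - t} \<le> exp (- t\<^sup>2 / (2 * card J))"
proof -
  interpret neg: iid_std_normal M "\<lambda>i \<omega>. - 1 * X i \<omega>" I
    by (rule scale_unit) simp
  show ?thesis
    using neg.prob_sum_ge_upper[OF assms] by (simp add: sum_negf le_minus_iff)
qed

text \<open>Sums over disjoint blocks are independent. Each stays below \<open>t\<close> with
  probability at most \<open>1 - p \<le> exp (- p)\<close>, where \<open>p\<close> is the lower tail
  bound for a block of \<open>d\<close> entries.\<close>

lemma prob_all_sums_less:
  assumes N: "\<And>v. v \<in> V \<Longrightarrow> N v \<subseteq> I" "\<And>v. v \<in> V \<Longrightarrow> card (N v) = d" "d > 0"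
    and disj: "disjoint_family_on N V" and V: "finite V" and t: "t \<ge> 0"
  shows "prob {\<omega> \<in> space M. \<forall>v\<in>V. (\<Sum>i\<in>N v. X i \<omega>) < t}
           \<le> exp (- real (card V) * (exp (- (t / sqrt d + 1)\<^sup>2 / 2) / sqrt (2 * pi)))"
proof (cases "V = {}")
  case True
  then show ?thesis by (simp add: prob_space)
next
  case False
  let ?p = "exp (- (t / sqrt d + 1)\<^sup>2 / 2) / sqrt (2 * pi)"
  let ?S = "\<lambda>v \<omega>. \<Sum>i\<in>N v. X i \<omega>"
  have "indep_vars (\<lambda>v. PiM (N v) (\<lambda>_. borel)) (\<lambda>v \<omega>. restrict (\<lambda>i. X i \<omega>) (N v)) V"
    using indep N(1) disj by (rule indep_vars_restrict)
  then have "indep_vars (\<lambda>_. borel) (\<lambda>v \<omega>. (\<lambda>f. \<Sum>i\<in>N v. f i :: real) (restrict (\<lambda>i. X i \<omega>) (N v))) V"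
    by (rule indep_vars_compose2) measurable
  then have ind: "indep_vars (\<lambda>_. borel) ?S V" by simp
  have "{\<omega> \<in> space M. \<forall>v\<in>V. ?S v \<omega> < t} = (\<Inter>v\<in>V. ?S v -` {..<t} \<inter> space M)"
    using False by auto
  also have "prob \<dots> = (\<Prod>v\<in>V. prob (?S v -` {..<t} \<inter> space M))"
    using ind False V by (rule indep_varsD_finite) auto
  also have "\<dots> \<le> (\<Prod>v\<in>V. exp (- ?p))"
  proof (rule prod_mono, safe)
    fix v assume v: "v \<in> V"
    have ne: "N v \<noteq> {}" using N(2)[OF v] N(3) by auto
    have meas: "{\<omega> \<in> space M. t \<le> ?S v \<omega>} \<in> events"
      using sum_measurable[OF N(1)[OF v]] by measurable
    have "?S v -` {..<t} \<inter> space M = space M - {\<omega> \<in> space M. t \<le> ?S v \<omega>}"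
      by auto
    then have "prob (?S v -` {..<t} \<inter> space M) = 1 - prob {\<omega> \<in> space M. t \<le> ?S v \<omega>}"
      using prob_compl[OF meas] by simp
    also have "\<dots> \<le> 1 - ?p"
      using prob_sum_ge_lower[OF N(1)[OF v] ne t] N(2)[OF v] by simp
    also have "\<dots> \<le> exp (- ?p)" using exp_ge_add_one_self[of "- ?p"] by simp
    finally show "prob (?S v -` {..<t} \<inter> space M) \<le> exp (- ?p)" .
  qed simp
  also have "\<dots> = exp (- real (card V) * ?p)"
    by (simp flip: exp_of_nat_mult)
  finally show ?thesis .
qed

end

section \<open>Differing pairs of two assignments\<close>

text \<open>Ordered pairs are used because \<open>W\<close> is not symmetric: the positions
  \<open>(i, j)\<close> and \<open>(j, i)\<close> carry separate noise.\<close>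

definition differing_pairs :: "nat \<Rightarrow> (nat \<Rightarrow> real) \<Rightarrow> (nat \<Rightarrow> real) \<Rightarrow> (nat \<times> nat) set" where
  "differing_pairs n x y =
     {(i, j) \<in> {1..n} \<times> {1..n}. K_mat x i j \<noteq> K_mat y i j}"

text \<open>Unlike \<open>differing_pairs\<close>, this set depends on the actual colors and not
  only on the induced partitions, which is why competitors have to be relabelled before their moved
  vertices are counted.\<close>

definition moved :: "nat \<Rightarrow> (nat \<Rightarrow> real) \<Rightarrow> (nat \<Rightarrow> real) \<Rightarrow> nat set" where
  "moved n x y = {v \<in> {1..n}. x v \<noteq> y v}"

definition ls_objective ::
    "nat \<Rightarrow> (nat \<Rightarrow> nat \<Rightarrow> real) \<Rightarrow> (nat \<Rightarrow> real) \<Rightarrow> real" where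
  "ls_objective n R x = (frobenius_norm n (\<lambda>i j. R i j - K_mat x i j))\<^sup>2"

lemma differing_pairs_iff:
  "(i, j) \<in> differing_pairs n x y \<longleftrightarrow> i \<in> {1..n} \<and> j \<in> {1..n} \<and> (x i = x j) \<noteq> (y i = y j)"
  by (auto simp: differing_pairs_def K_mat_def)

lemma finite_differing_pairs [simp]: "finite (differing_pairs n x y)"
  by (rule finite_subset[of _ "{1..n} \<times> {1..n}"]) (auto simp: differing_pairs_iff)

lemma finite_moved [simp]: "finite (moved n x y)"
  by (simp add: moved_def)

lemma equiv_class_iff:
  assumes "x \<in> assignments col k n"
  shows "x \<in> equiv_class col k n y \<longleftrightarrow> differing_pairs n x y = {}"
proof -
  have "differing_pairs n x y = {} \<longleftrightarrow> (\<forall>i j. (i, j) \<notin> differing_pairs n x y)"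
    by auto
  also have "\<dots> \<longleftrightarrow> (\<forall>i\<in>{1..n}. \<forall>j\<in>{1..n}. (x i = x j) = (y i = y j))"
    unfolding differing_pairs_iff by blast
  finally show ?thesis using assms unfolding equiv_class_def by blast
qed

lemma ls_objective_eq_sum:
  "ls_objective n R x = (\<Sum>(i, j)\<in>{1..n} \<times> {1..n}. (R i j - K_mat x i j)\<^sup>2)"
  unfolding ls_objective_def frobenius_norm_def
  by (subst real_sqrt_pow2) (auto intro!: sum_nonneg simp: sum.cartesian_product)

text \<open>The factor \<open>1 - 2 * K_mat y i j\<close> is the sign of \<open>K_mat x i j - K_mat y i j\<close> at every
  differing pair, whatever \<open>x\<close> is.\<close>

lemma ls_objective_diff:
  "ls_objective n (observation y \<sigma> W \<omega>) x - ls_objective n (observation y \<sigma> W \<omega>) y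
     = real (card (differing_pairs n x y))
       - 2 * \<bar>\<sigma>\<bar> * (\<Sum>(i, j)\<in>differing_pairs n x y.
            (if \<sigma> < 0 then - 1 else 1) * (1 - 2 * K_mat y i j) * W i j \<omega>)"
proof -
  have "ls_objective n (observation y \<sigma> W \<omega>) x - ls_objective n (observation y \<sigma> W \<omega>) y
     = (\<Sum>(i, j)\<in>{1..n} \<times> {1..n}. (observation y \<sigma> W \<omega> i j - K_mat x i j)\<^sup>2
           - (observation y \<sigma> W \<omega> i j - K_mat y i j)\<^sup>2)"
    unfolding ls_objective_eq_sum by (simp add: sum_subtractf split_def)
  \<comment> \<open>With \<open>d = K_mat x i j - K_mat y i j\<close> the summand is
    \<open>d\<^sup>2 - 2 * \<sigma> * d * W i j \<omega>\<close>. It vanishes for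
    \<open>d = 0\<close>; otherwise \<open>d\<^sup>2 = 1\<close>, and the sign of \<sigma> is
    shifted to the noise.\<close>
  also have "\<dots> = (\<Sum>(i, j)\<in>differing_pairs n x y. 1
           - 2 * \<bar>\<sigma>\<bar> * ((if \<sigma> < 0 then - 1 else 1) * (1 - 2 * K_mat y i j) * W i j \<omega>))"
    by (rule sum.mono_neutral_cong_right)
      (auto simp: differing_pairs_def K_mat_def observation_def power2_eq_square algebra_simps
            split: if_splits)
  also have "\<dots> = real (card (differing_pairs n x y))
       - 2 * \<bar>\<sigma>\<bar> * (\<Sum>(i, j)\<in>differing_pairs n x y.
            (if \<sigma> < 0 then - 1 else 1) * (1 - 2 * K_mat y i j) * W i j \<omega>)"
    by (simp add: sum_subtractf sum_distrib_left split_def)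
  finally show ?thesis .
qed

text \<open>A moved vertex disagrees with every unmoved vertex of the class it leaves and of the
  class it enters. At least \<open>S\<close> minus the number of moved vertices are available, and
  each such pair counts in both orders. The subtraction is truncated, so the bound is trivial once
  the moved vertices outnumber \<open>S\<close>.\<close>

lemma card_differing_pairs_ge:
  assumes sizes: "\<And>v. v \<in> {1..n} \<Longrightarrow> y v \<noteq> x v
      \<Longrightarrow> S \<le> card {u \<in> {1..n}. y u = y v \<or> y u = x v}"
  shows "2 * card (moved n x y) * (S - card (moved n x y)) \<le> card (differing_pairs n x y)"
proof -
  let ?B = "moved n x y"
  define T where "T v = {u \<in> {1..n}. y u = y v \<or> y u = x v} - ?B" for v
  have T: "S - card ?B \<le> card (T v)" if "v \<in> ?B" for v
  proof -
    have "S \<le> card {u \<in> {1..n}. y u = y v \<or> y u = x v}"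
      using sizes[of v] that by (auto simp: moved_def)
    then show ?thesis
      unfolding T_def using diff_card_le_card_Diff[of ?B "{u \<in> {1..n}. y u = y v \<or> y u = x v}"]
      by simp
  qed
  have finT: "finite (T v)" for v by (simp add: T_def)
  let ?P = "Sigma ?B T"
  have cP: "card ?B * (S - card ?B) \<le> card ?P"
    using sum_bounded_below[of ?B "S - card ?B" "\<lambda>v. card (T v)"] T finT by simp
  \<comment> \<open>First components in \<open>?P\<close> are moved and second components are not,
    so \<open>?P\<close> and its mirror image are disjoint.\<close>
  have "card ?P + card (prod.swap ` ?P) = card (?P \<union> prod.swap ` ?P)"
    by (rule card_Un_disjoint[symmetric]) (auto simp: T_def finT)
  also have "card (prod.swap ` ?P) = card ?P"
    by (rule card_image) (auto intro: inj_onI)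
  also have "card (?P \<union> prod.swap ` ?P) \<le> card (differing_pairs n x y)"
  proof (rule card_mono)
    have "(v, u) \<in> differing_pairs n x y" "(u, v) \<in> differing_pairs n x y"
      if "v \<in> ?B" "u \<in> T v" for u v
    proof -
      have "v \<in> {1..n}" "u \<in> {1..n}" "x v \<noteq> y v" "x u = y u" "y u = y v \<or> y u = x v"
        using that by (auto simp: moved_def T_def)
      then show "(v, u) \<in> differing_pairs n x y" "(u, v) \<in> differing_pairs n x y"
        unfolding differing_pairs_iff by metis+
    qed
    then show "?P \<union> prod.swap ` ?P \<subseteq> differing_pairs n x y" by auto
  qed simp
  finally show ?thesis using cP by simp
qed

text \<open>An assignment is determined by its moved set and its colors there, as it agrees with
  \<open>y\<close> elsewhere. There are at most \<open>n ^ m\<close> sets and at most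
  \<open>k ^ m\<close> colorings of each.\<close>

lemma card_assignments_moved_le:
  assumes "y \<in> assignments col k n" and "m \<le> n"
  shows "card {x \<in> assignments col k n. card (moved n x y) = m} \<le> (n * k) ^ m"
proof -
  let ?P = "palette col k"
  have cP: "finite ?P" "card ?P \<le> k"
    unfolding palette_def using card_image_le[of "{1..k}" col] by auto
  let ?F = "\<lambda>B. {x \<in> assignments col k n. moved n x y = B}"
  let ?Bs = "{B. B \<subseteq> {1..n} \<and> card B = m}"
  have fin_assign: "finite (assignments col k n)"
    unfolding assignments_def using cP by (intro finite_PiE) auto
  have F: "card (?F B) \<le> k ^ m" if "B \<in> ?Bs" for B
  proof -
    have B: "finite B" "B \<subseteq> {1..n}" "card B = m" using that finite_subset by auto
    have "inj_on (\<lambda>x. restrict x B) (?F B)"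
    proof (rule inj_onI)
      fix x x' assume xx: "x \<in> ?F B" "x' \<in> ?F B" and eq: "restrict x B = restrict x' B"
      show "x = x'"
      proof (rule PiE_ext)
        show "x \<in> {1..n} \<rightarrow>\<^sub>E ?P" "x' \<in> {1..n} \<rightarrow>\<^sub>E ?P"
          using xx by (auto simp: assignments_def)
        fix v assume v: "v \<in> {1..n}"
        show "x v = x' v"
        proof (cases "v \<in> B")
          case True then show ?thesis using fun_cong[OF eq, of v] by simp
        next
          case False
          then have "v \<notin> moved n x y" "v \<notin> moved n x' y" using xx by auto
          then show ?thesis using v by (auto simp: moved_def)
        qed
      qed
    qed
    moreover have "(\<lambda>x. restrict x B) ` ?F B \<subseteq> B \<rightarrow>\<^sub>E ?P"
      using B by (fastforce simp: assignments_def PiE_iff)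
    moreover have "finite (B \<rightarrow>\<^sub>E ?P)" using B cP by (intro finite_PiE) auto
    ultimately have "card (?F B) \<le> card (B \<rightarrow>\<^sub>E ?P)" by (rule card_inj_on_le)
    also have "\<dots> = card ?P ^ m" using B by (simp add: card_PiE)
    also have "\<dots> \<le> k ^ m" using cP by (simp add: power_mono)
    finally show ?thesis .
  qed
  have finBs: "finite ?Bs" by simp
  have "{x \<in> assignments col k n. card (moved n x y) = m} \<subseteq> (\<Union>B\<in>?Bs. ?F B)"
    by (auto simp: moved_def)
  then have "card {x \<in> assignments col k n. card (moved n x y) = m} \<le> card (\<Union>B\<in>?Bs. ?F B)"
    using fin_assign finBs by (intro card_mono) auto
  also have "\<dots> \<le> (\<Sum>B\<in>?Bs. card (?F B))" by (rule card_UN_le[OF finBs])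
  also have "\<dots> \<le> card ?Bs * k ^ m" using sum_bounded_above[OF F, of ?Bs] by simp
  also have "card ?Bs = n choose m" using n_subsets[of "{1..n}" m] by simp
  also have "(n choose m) * k ^ m \<le> n ^ m * k ^ m"
    using binomial_le_pow[OF assms(2)] by simp
  finally show ?thesis by (simp add: power_mult_distrib)
qed

text \<open>If few pairs differ, every class of \<open>y\<close> has a dominant color under
  \<open>x\<close>, and distinct classes have distinct dominant colors. Undoing this permutation of
  the palette leaves only the minority vertices of each class moved, and each of these differs from
  all dominant vertices of its class.\<close>

lemma equivalent_near_or_far:
  fixes y :: "nat \<Rightarrow> real"
  assumes x: "x \<in> assignments col k n" and y: "y \<in> assignments col k n"
    and inj: "inj_on col {1..k}" and "k \<ge> 1" and "c > 0"
    and sizes: "\<And>i. i \<in> {1..k} \<Longrightarrow> c * real n \<le> color_count n y (col i)"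
    and few: "real (card (differing_pairs n x y)) < (c * real n / k)\<^sup>2"
  obtains x' where "x' \<in> assignments col k n" "\<And>i j. i \<in> {1..n} \<Longrightarrow> j \<in> {1..n} \<Longrightarrow> x' i = x' j \<longleftrightarrow> x i = x j"
    "real (card (moved n x' y)) * (c * real n) \<le> real k ^ 2 * card (differing_pairs n x y)"
proof -
  let ?P = "palette col k" and ?D = "differing_pairs n x y"
  define C where "C a = {v \<in> {1..n}. y v = a}" for a
  define t where "t b a = {v \<in> C a. x v = b}" for a b
  have P: "finite ?P" "card ?P = k" using inj by (auto simp: palette_def card_image)
  have n: "real n > 0" using few \<open>c > 0\<close> by (cases "n = 0") auto
  have finC: "finite (C a)" "finite (t b a)" for a b by (auto simp: C_def t_def)
  have cC: "c * n \<le> card (C a)" if a: "a \<in> ?P" for a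
  proof -
    obtain i where "i \<in> {1..k}" "a = col i" using a by (auto simp: palette_def)
    moreover have "y -` {a} \<inter> {1..n} = C a" by (auto simp: C_def)
    ultimately show ?thesis using sizes[of i] by (simp add: color_count_def)
  qed
  have xP: "x v \<in> ?P" "y v \<in> ?P" if "v \<in> {1..n}" for v using x y that by (auto simp: assignments_def)
  \<comment> \<open>Pigeonhole: if each of the \<open>k\<close> colors took fewer than
    \<open>c * n / k\<close> vertices of the class, the class would have fewer than
    \<open>c * n\<close> vertices.\<close>
  have "\<exists>b\<in>?P. c * n / k \<le> card (t b a)" if a: "a \<in> ?P" for a
  proof (rule ccontr)
    assume "\<not> ?thesis"
    then have "\<And>b. b \<in> ?P \<Longrightarrow> real (card (t b a)) < c * n / k" by auto
    then have "(\<Sum>b\<in>?P. real (card (t b a))) < of_nat (card ?P) * (c * n / k)"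
      using \<open>k \<ge> 1\<close> P by (intro sum_bounded_above_strict) auto
    also have "\<dots> = c * n" using P \<open>k \<ge> 1\<close> by simp
    also have "\<dots> \<le> card (C a)" using cC a .
    also have "C a = (\<Union>b\<in>?P. t b a)" using xP by (auto simp: t_def C_def)
    also have "real (card (\<Union>b\<in>?P. t b a)) \<le> (\<Sum>b\<in>?P. real (card (t b a)))"
      using card_UN_le[OF P(1), of "\<lambda>b. t b a"] by (simp flip: of_nat_sum)
    finally show False by simp
  qed
  then obtain p where p: "\<And>a. a \<in> ?P \<Longrightarrow> p a \<in> ?P" 
      "\<And>a. a \<in> ?P \<Longrightarrow> c * n / k \<le> card (t (p a) a)" by metis
  have pos: "c * n / k > 0" using \<open>c > 0\<close> n \<open>k \<ge> 1\<close> by simp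
  \<comment> \<open>If two classes shared a dominant color, \<open>x\<close> would merge their
    dominant parts, and all pairs between these parts would differ. That is at least
    \<open>(c * n / k)\<^sup>2\<close> pairs, against \<open>few\<close>.\<close>
  have pinj: "inj_on p ?P"
  proof (rule inj_onI, rule ccontr)
    fix a a' assume a: "a \<in> ?P" "a' \<in> ?P" "p a = p a'" "a \<noteq> a'"
    have "t (p a) a \<times> t (p a') a' \<subseteq> ?D" 
      using a by (auto simp: t_def C_def differing_pairs_iff)
    then have "card (t (p a) a) * card (t (p a') a') \<le> card ?D"
      by (metis card_mono finite_differing_pairs card_cartesian_product)
    then have "real (card (t (p a) a)) * real (card (t (p a') a')) \<le> card ?D"
      by (simp flip: of_nat_mult)
    moreover have "(c * n / k) * (c * n / k) \<le> real (card (t (p a) a)) * real (card (t (p a') a'))"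
      using p(2)[OF a(1)] p(2)[OF a(2)] pos by (intro mult_mono) auto
    ultimately show False using few by (simp add: power2_eq_square)
  qed
  have pbij: "bij_betw p ?P ?P"
    using pinj p(1) P(1) by (simp add: bij_betw_def endo_inj_surj image_subset_iff)
  define q where "q = inv_into ?P p"
  have q: "q b \<in> ?P" "p (q b) = b" if "b \<in> ?P" for b
    using that pbij unfolding q_def bij_betw_def by (metis inv_into_into, metis f_inv_into_f)
  have qp: "q (p a) = a" if "a \<in> ?P" for a using that pinj by (simp add: q_def)
  define x' where "x' = restrict (q \<circ> x) {1..n}"
  show ?thesis
  proof
    show "x' \<in> assignments col k n" using xP q by (auto simp: assignments_def x'_def)
    show "x' i = x' j \<longleftrightarrow> x i = x j" if "i \<in> {1..n}" "j \<in> {1..n}" for i j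
    proof -
      have "q (x i) = q (x j) \<longleftrightarrow> x i = x j"
        using q(2)[OF xP(1)[OF that(1)]] q(2)[OF xP(1)[OF that(2)]] by metis
      then show ?thesis using that by (simp add: x'_def)
    qed
    \<comment> \<open>The minority vertices of the class \<open>a\<close>; all other vertices of
      that class get back the color \<open>a\<close> under \<open>x'\<close>.\<close>
    define m where "m a = {v \<in> C a. x v \<noteq> p a}" for a
    have m: "real (card (m a)) * (c * n / k) \<le> card ?D" if "a \<in> ?P" for a
    proof -
      have "m a \<times> t (p a) a \<subseteq> ?D" 
        by (auto simp: m_def t_def C_def differing_pairs_iff)
      then have "card (m a) * card (t (p a) a) \<le> card ?D"
        by (metis card_mono finite_differing_pairs card_cartesian_product)
      then have "real (card (m a)) * real (card (t (p a) a)) \<le> card ?D"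
        by (simp flip: of_nat_mult)
      moreover have "real (card (m a)) * (c * n / k) \<le> real (card (m a)) * real (card (t (p a) a))"
        using p(2)[OF that] by (intro mult_left_mono) auto
      ultimately show ?thesis by simp
    qed
    have "moved n x' y \<subseteq> (\<Union>a\<in>?P. m a)"
      using xP qp by (auto simp: moved_def x'_def m_def C_def)
    then have "card (moved n x' y) \<le> card (\<Union>a\<in>?P. m a)"
      using P by (intro card_mono) (auto simp: m_def finC)
    also have "\<dots> \<le> (\<Sum>a\<in>?P. card (m a))" by (rule card_UN_le[OF P(1)])
    finally have "real (card (moved n x' y)) \<le> (\<Sum>a\<in>?P. real (card (m a)))" 
      by (simp flip: of_nat_sum)
    then have "real (card (moved n x' y)) * (c * n / k) \<le> (\<Sum>a\<in>?P. real (card (m a))) * (c * n / k)"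
      using pos by (intro mult_right_mono) auto
    also have "\<dots> = (\<Sum>a\<in>?P. real (card (m a)) * (c * n / k))" by (rule sum_distrib_right)
    also have "\<dots> \<le> (\<Sum>a\<in>?P. real (card ?D))" by (intro sum_mono m)
    also have "\<dots> = real k * real (card ?D)" using P(2) by simp
    \<comment> \<open>One factor \<open>k\<close> comes from bounding each of the \<open>k\<close>
      classes by the whole set of differing pairs, the other from the denominator of
      \<open>c * n / k\<close>.\<close>
    finally have "real k * (real (card (moved n x' y)) * (c * n / k)) \<le> real k * (real k * card ?D)"
      by (rule mult_left_mono) simp
    then show "real (card (moved n x' y)) * (c * n) \<le> real k ^ 2 * card ?D"
      using \<open>k \<ge> 1\<close> by (simp add: power2_eq_square)
  qed
qed

section \<open>The union bound over competitors\<close>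

lemma iid_std_normal_signed_matrix:
  assumes "prob_space M" and W: "std_gaussian_matrix M n W"
    and g: "\<And>i j. \<bar>g i j\<bar> = (1::real)"
  shows "iid_std_normal M (\<lambda>(i, j) \<omega>. g i j * W i j \<omega>) ({1..n} \<times> {1..n})"
proof -
  interpret prob_space M by fact
  interpret iid_std_normal M "\<lambda>(i, j). W i j" "{1..n} \<times> {1..n}"
    using W by unfold_locales (auto simp: std_gaussian_matrix_def)
  have "iid_std_normal M (\<lambda>p \<omega>. (\<lambda>(i, j). g i j) p * (\<lambda>(i, j). W i j) p \<omega>) ({1..n} \<times> {1..n})"
    by (rule scale_unit) (auto simp: g)
  then show ?thesis by (simp add: split_def)
qed

lemma finite_assignments: "finite (assignments col k n)"
  unfolding assignments_def palette_def by (intro finite_PiE) auto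

lemma card_assignments_le: "card (assignments col k n) \<le> k ^ n"
proof -
  have "card (palette col k) \<le> k" unfolding palette_def using card_image_le[of "{1..k}" col] by simp
  then show ?thesis unfolding assignments_def by (simp add: card_PiE power_mono)
qed

text \<open>With \<open>d\<close> differing pairs, a noise sum of variance \<open>d\<close> has to
  reach \<open>d / (2 * \<bar>\<sigma>\<bar>)\<close>, which gives the exponent
  \<open>d / (8 * \<sigma>\<^sup>2)\<close>. Passing to a positive upper bound \<tau> of the
  variance also covers \<open>\<sigma> = 0\<close>, where the event is empty.\<close>

lemma prob_objective_le:
  fixes W :: "nat \<Rightarrow> nat \<Rightarrow> 'w \<Rightarrow> real" and y :: "nat \<Rightarrow> real" and \<sigma> :: real
  defines "R \<equiv> observation y \<sigma> W"
  assumes "prob_space M" and W: "std_gaussian_matrix M n W"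
    and ne: "differing_pairs n x y \<noteq> {}" and \<tau>: "\<sigma>\<^sup>2 \<le> \<tau>" "\<tau> > 0"
  shows "{\<omega> \<in> space M. ls_objective n (R \<omega>) x \<le> ls_objective n (R \<omega>) y} \<in> sets M" (is "?B \<in> _")
    and "measure M {\<omega> \<in> space M. ls_objective n (R \<omega>) x \<le> ls_objective n (R \<omega>) y}
           \<le> exp (- real (card (differing_pairs n x y)) / (8 * \<tau>))"
proof -
  let ?D = "differing_pairs n x y"
  let ?d = "real (card ?D)"
  define g where "g i j = (if \<sigma> < 0 then - 1 else 1) * (1 - 2 * K_mat y i j)" for i j
  define X where "X = (\<lambda>(i, j) \<omega>. g i j * W i j \<omega>)"
  interpret iid_std_normal M X "{1..n} \<times> {1..n}"
    unfolding X_def using assms by (intro iid_std_normal_signed_matrix) (auto simp: g_def K_mat_def)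
  have D: "?D \<subseteq> {1..n} \<times> {1..n}" by (auto simp: differing_pairs_def)
  have d: "?d > 0" using ne by (simp add: card_gt_0_iff)
  have B: "?B = {\<omega> \<in> space M. ?d \<le> 2 * \<bar>\<sigma>\<bar> * (\<Sum>p\<in>?D. X p \<omega>)}"
  proof -
    have "ls_objective n (R \<omega>) x - ls_objective n (R \<omega>) y
        = ?d - 2 * \<bar>\<sigma>\<bar> * (\<Sum>p\<in>?D. X p \<omega>)" for \<omega>
      unfolding R_def ls_objective_diff X_def g_def by (simp add: split_def)
    then have "ls_objective n (R \<omega>) x \<le> ls_objective n (R \<omega>) y
        \<longleftrightarrow> ?d \<le> 2 * \<bar>\<sigma>\<bar> * (\<Sum>p\<in>?D. X p \<omega>)" for \<omega>
      by (metis diff_le_0_iff_le)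
    then show ?thesis by simp
  qed
  show "?B \<in> sets M" unfolding B using sum_measurable[OF D] by measurable
  show "prob ?B \<le> exp (- ?d / (8 * \<tau>))"
  proof (cases "\<sigma> = 0")
    case True
    then have "?B = {}" unfolding B using d ne by simp
    then show ?thesis by (simp only: measure_empty exp_ge_zero)
  next
    case False
    have "?B = {\<omega> \<in> space M. (\<Sum>p\<in>?D. X p \<omega>) \<ge> ?d / (2 * \<bar>\<sigma>\<bar>)}"
      unfolding B using False by (auto simp: field_simps)
    then have "prob ?B \<le> exp (- (?d / (2 * \<bar>\<sigma>\<bar>))\<^sup>2 / (2 * ?d))"
      using prob_sum_ge_upper[OF D ne, of "?d / (2 * \<bar>\<sigma>\<bar>)"] by simp
    moreover have "- (?d / (2 * \<bar>\<sigma>\<bar>))\<^sup>2 / (2 * ?d) = - (?d / (8 * \<sigma>\<^sup>2))"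
      using d False by (simp add: field_simps power2_eq_square)
    ultimately have "prob ?B \<le> exp (- (?d / (8 * \<sigma>\<^sup>2)))" by simp
    also have "exp (- (?d / (8 * \<sigma>\<^sup>2))) \<le> exp (- ?d / (8 * \<tau>))"
      using d False \<tau> by (simp add: frac_le)
    finally show ?thesis .
  qed
qed

text \<open>The competitors split into near ones, which move at most \<open>\<epsilon> * n\<close>
  vertices, and far ones, with quadratically many differing pairs. By \<open>near\<close>, the near
  ones with \<open>m\<close> moved vertices contribute at most \<open>\<rho> ^ m\<close>, summing to
  a geometric series; the far ones are few enough to be counted by \<open>k ^ n\<close>.\<close>

lemma prob_better_competitor_le:
  fixes n k S :: nat and W :: "nat \<Rightarrow> nat \<Rightarrow> 'w \<Rightarrow> real" and y :: "nat \<Rightarrow> real" and \<sigma> \<tau> \<epsilon> \<rho> c :: real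
  defines "R \<equiv> observation y \<sigma> W"
  defines "Bad \<equiv> (\<lambda>M x. {\<omega> \<in> space M. ls_objective n (R \<omega>) x \<le> ls_objective n (R \<omega>) y})"
  assumes M: "prob_space M" and W: "std_gaussian_matrix M n W"
    and y: "y \<in> assignments col k n" and inj: "inj_on col {1..k}" and k: "k \<ge> 1" and c: "c > 0"
    and sizes: "\<And>i. i \<in> {1..k} \<Longrightarrow> c * real n \<le> color_count n y (col i)"
    and pairs: "\<And>a b. a \<in> palette col k \<Longrightarrow> b \<in> palette col k \<Longrightarrow> a \<noteq> b \<Longrightarrow>
        S \<le> card {u \<in> {1..n}. y u = a \<or> y u = b}"
    and \<tau>: "\<sigma>\<^sup>2 \<le> \<tau>" "\<tau> > 0" and \<rho>: "0 \<le> \<rho>" "\<rho> < 1" and \<epsilon>: "\<epsilon> > 0"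
    and near: "\<And>m. m \<ge> 1 \<Longrightarrow> m \<le> \<epsilon> * n \<Longrightarrow>
        real (n * k) ^ m * exp (- (m * (real S - m)) / (4 * \<tau>)) \<le> \<rho> ^ m"
  shows "(\<Union>x\<in>assignments col k n - equiv_class col k n y. Bad M x) \<in> sets M"
    and "measure M (\<Union>x\<in>assignments col k n - equiv_class col k n y. Bad M x)
      \<le> \<rho> / (1 - \<rho>) + real k ^ n * exp (- (min ((c / real k)\<^sup>2) (\<epsilon> * c / (real k)\<^sup>2) * (real n)\<^sup>2) / (8 * \<tau>))"
proof -
  interpret prob_space M by fact
  let ?\<Omega> = "assignments col k n"
  let ?D = "\<lambda>x. differing_pairs n x y"
  let ?m = "\<lambda>x. card (moved n x y)"
  \<comment> \<open>The first entry keeps the differing pairs of a non-far competitor below the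
    threshold \<open>(c * n / k)\<^sup>2\<close> of \<open>equivalent_near_or_far\<close>; the
    second then makes its relabelling move fewer than \<open>\<epsilon> * n\<close>
    vertices.\<close>
  let ?\<eta> = "min ((c / real k)\<^sup>2) (\<epsilon> * c / (real k)\<^sup>2)"
  define Near where "Near = {x \<in> ?\<Omega>. ?D x \<noteq> {} \<and> ?m x \<le> \<epsilon> * n}"
  define Far where "Far = {x \<in> ?\<Omega>. ?D x \<noteq> {} \<and> ?\<eta> * (real n)\<^sup>2 \<le> card (?D x)}"
  have fin: "finite ?\<Omega>" "finite Near" "finite Far"
    using finite_assignments by (auto simp: Near_def Far_def)
  have out: "?\<Omega> - equiv_class col k n y = {x \<in> ?\<Omega>. ?D x \<noteq> {}}"
    using equiv_class_iff by blast
  have meas: "Bad M x \<in> events" if "?D x \<noteq> {}" for x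
    unfolding Bad_def R_def using M W that \<tau> by (rule prob_objective_le)
  show ev: "(\<Union>x\<in>?\<Omega> - equiv_class col k n y. Bad M x) \<in> events"
    unfolding out using fin meas by (intro sets.finite_UN) auto
  have bad: "prob (Bad M x) \<le> exp (- real (card (?D x)) / (8 * \<tau>))" if "?D x \<noteq> {}" for x
    unfolding Bad_def R_def using M W that \<tau> by (rule prob_objective_le)
  \<comment> \<open>A competitor that is not far has a near relabelling with the same objective,
    hence with the same bad event.\<close>
  have cover: "Bad M x \<subseteq> (\<Union>x\<in>Near. Bad M x) \<union> (\<Union>x\<in>Far. Bad M x)"
    if x: "x \<in> ?\<Omega>" "?D x \<noteq> {}" for x
  proof (cases "x \<in> Far")
    case False
    then have less: "card (?D x) < ?\<eta> * (real n)\<^sup>2" using x by (auto simp: Far_def)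
    also have "\<dots> \<le> (c / real k)\<^sup>2 * (real n)\<^sup>2" by (intro mult_right_mono) auto
    also have "\<dots> = (c * n / k)\<^sup>2" by (simp add: power_mult_distrib power_divide)
    finally obtain x' where x': "x' \<in> ?\<Omega>"
        "\<And>i j. i \<in> {1..n} \<Longrightarrow> j \<in> {1..n} \<Longrightarrow> x' i = x' j \<longleftrightarrow> x i = x j"
        "real (?m x') * (c * real n) \<le> real k ^ 2 * card (?D x)"
      using equivalent_near_or_far[OF x(1) y inj k c sizes] by blast
    have DD: "?D x' = ?D x" using x'(2) by (auto simp: differing_pairs_def K_mat_def)
    have n: "n > 0" using x(2) by (auto simp: differing_pairs_def)
    have "real k ^ 2 * card (?D x) < real k ^ 2 * (?\<eta> * (real n)\<^sup>2)"
      using less k by (intro mult_strict_left_mono) auto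
    also have "\<dots> \<le> real k ^ 2 * (\<epsilon> * c / (real k)\<^sup>2 * (real n)\<^sup>2)"
      by (intro mult_left_mono mult_right_mono) auto
    also have "\<dots> = (\<epsilon> * n) * (c * n)" using k by (simp add: power2_eq_square)
    finally have "real (?m x') * (c * n) < (\<epsilon> * n) * (c * n)" using x'(3) by linarith
    then have "real (?m x') < \<epsilon> * n" using c n by (simp add: mult_less_cancel_right)
    then have "x' \<in> Near" using x' x DD by (simp add: Near_def)
    moreover have obj: "ls_objective n r x' = ls_objective n r x" for r
    proof -
      have "K_mat x' i j = K_mat x i j" if "i \<in> {1..n}" "j \<in> {1..n}" for i j
        using x'(2)[OF that] by (simp add: K_mat_def)
      then show ?thesis unfolding ls_objective_eq_sum by (intro sum.cong) auto
    qed
    ultimately show ?thesis unfolding Bad_def obj[symmetric] by blast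
  qed blast
  have near_sum: "(\<Sum>x\<in>Near. prob (Bad M x)) \<le> \<rho> / (1 - \<rho>)"
  proof -
    let ?T = "{m \<in> {1..n}. m \<le> \<epsilon> * n}"
    let ?e = "\<lambda>m. exp (- (real m * (real S - m)) / (4 * \<tau>))"
    have bd: "prob (Bad M x) \<le> ?e (?m x)" if "x \<in> Near" for x
    proof -
      have "2 * ?m x * (S - ?m x) \<le> card (?D x)"
      proof (rule card_differing_pairs_ge)
        fix v assume "v \<in> {1..n}" "y v \<noteq> x v"
        then show "S \<le> card {u \<in> {1..n}. y u = y v \<or> y u = x v}"
          using y that by (intro pairs) (auto simp: Near_def assignments_def)
      qed
      then have "real (2 * ?m x * (S - ?m x)) \<le> card (?D x)" by (simp only: of_nat_le_iff)
      \<comment> \<open>The real difference lies below the truncated one and may be negative, in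
        which case the bound is trivial.\<close>
      moreover have "2 * real (?m x) * (real S - ?m x) \<le> real (2 * ?m x * (S - ?m x))"
        by (simp add: mult_left_mono of_nat_diff_real)
      ultimately have "2 * real (?m x) * (real S - ?m x) \<le> card (?D x)" by linarith
      then have "exp (- real (card (?D x)) / (8 * \<tau>)) \<le> ?e (?m x)"
        using \<tau> by (simp add: field_simps)
      moreover have "?D x \<noteq> {}" using that by (simp add: Near_def)
      ultimately show ?thesis using bad[of x] by linarith
    qed
    \<comment> \<open>An inequivalent assignment moves at least one vertex, so the geometric series
      starts at \<open>m = 1\<close> and its sum carries a factor \<rho>.\<close>
    have img: "?m ` Near \<subseteq> ?T"
    proof (rule image_subsetI)
      fix x assume x: "x \<in> Near"
      have "moved n x y \<noteq> {}"
      proof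
        assume "moved n x y = {}"
        then have "?D x = {}" by (auto simp: moved_def differing_pairs_def K_mat_def)
        then show False using x by (simp add: Near_def)
      qed
      moreover have "?m x \<le> card {1..n}" by (rule card_mono) (auto simp: moved_def)
      ultimately show "?m x \<in> ?T" using x by (simp add: Near_def Suc_le_eq card_gt_0_iff)
    qed
    have "(\<Sum>x\<in>Near. prob (Bad M x)) \<le> (\<Sum>x\<in>Near. ?e (?m x))"
      by (intro sum_mono bd)
    also have "\<dots> = (\<Sum>m\<in>?T. \<Sum>x\<in>{x \<in> Near. ?m x = m}. ?e (?m x))"
      by (rule sum.group[symmetric]) (use fin img in auto)
    also have "\<dots> = (\<Sum>m\<in>?T. card {x \<in> Near. ?m x = m} * ?e m)"
      by (intro sum.cong) auto
    also have "\<dots> \<le> (\<Sum>m\<in>?T. \<rho> ^ m)"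
    proof (rule sum_mono)
      fix m assume m: "m \<in> ?T"
      have "card {x \<in> Near. ?m x = m} \<le> card {x \<in> ?\<Omega>. ?m x = m}"
        using fin by (intro card_mono) (auto simp: Near_def)
      also have "\<dots> \<le> (n * k) ^ m" using m y by (intro card_assignments_moved_le) auto
      finally have "real (card {x \<in> Near. ?m x = m}) \<le> real (n * k) ^ m"
        by (simp only: of_nat_power[symmetric] of_nat_le_iff)
      then have "card {x \<in> Near. ?m x = m} * ?e m \<le> real (n * k) ^ m * ?e m"
        by (intro mult_right_mono) auto
      also have "\<dots> \<le> \<rho> ^ m" using near[of m] m by auto
      finally show "card {x \<in> Near. ?m x = m} * ?e m \<le> \<rho> ^ m" .
    qed
    also have "\<dots> \<le> (\<Sum>m\<in>{1..n}. \<rho> ^ m)" using \<rho> by (intro sum_mono2) auto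
    also have "\<dots> = \<rho> * (\<Sum>m<n. \<rho> ^ m)"
      unfolding sum_distrib_left
      by (rule sum.reindex_bij_witness[of _ Suc "\<lambda>m. m - 1"]) (auto simp flip: power_Suc)
    also have "\<dots> \<le> \<rho> * (1 / (1 - \<rho>))"
      using \<rho> by (intro mult_left_mono) (auto simp: sum_gp_strict divide_right_mono)
    finally show ?thesis by simp
  qed
  have far_sum: "(\<Sum>x\<in>Far. prob (Bad M x)) \<le> real k ^ n * exp (- (?\<eta> * (real n)\<^sup>2) / (8 * \<tau>))"
  proof -
    have "prob (Bad M x) \<le> exp (- (?\<eta> * (real n)\<^sup>2) / (8 * \<tau>))" if "x \<in> Far" for x
    proof -
      have "exp (- real (card (?D x)) / (8 * \<tau>)) \<le> exp (- (?\<eta> * (real n)\<^sup>2) / (8 * \<tau>))"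
        using that \<tau> unfolding exp_le_cancel_iff
        by (intro divide_right_mono) (auto simp: Far_def)
      moreover have "?D x \<noteq> {}" using that by (simp add: Far_def)
      ultimately show ?thesis using bad[of x] by linarith
    qed
    then have "(\<Sum>x\<in>Far. prob (Bad M x)) \<le> card Far * exp (- (?\<eta> * (real n)\<^sup>2) / (8 * \<tau>))"
      by (rule sum_bounded_above)
    also have "card Far \<le> k ^ n"
      using card_mono[OF fin(1), of Far] card_assignments_le[of col k n] by (auto simp: Far_def)
    then have "card Far * exp (- (?\<eta> * (real n)\<^sup>2) / (8 * \<tau>)) \<le> real k ^ n * exp (- (?\<eta> * (real n)\<^sup>2) / (8 * \<tau>))"
      by (intro mult_right_mono) (simp_all only: of_nat_power[symmetric] of_nat_le_iff exp_ge_zero)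
    finally show ?thesis .
  qed
  have evs: "(\<Union>x\<in>Near. Bad M x) \<in> events" "(\<Union>x\<in>Far. Bad M x) \<in> events"
    using fin meas by (auto intro!: sets.finite_UN simp: Near_def Far_def)
  have "prob (\<Union>x\<in>?\<Omega> - equiv_class col k n y. Bad M x)
      \<le> prob ((\<Union>x\<in>Near. Bad M x) \<union> (\<Union>x\<in>Far. Bad M x))"
    unfolding out using cover evs by (intro finite_measure_mono) auto
  also have "\<dots> \<le> prob (\<Union>x\<in>Near. Bad M x) + prob (\<Union>x\<in>Far. Bad M x)"
    using evs by (rule measure_Un_le)
  also have "\<dots> \<le> (\<Sum>x\<in>Near. prob (Bad M x)) + (\<Sum>x\<in>Far. prob (Bad M x))"
    using fin meas by (intro add_mono finite_measure_subadditive_finite) (auto simp: Near_def Far_def)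
  also have "\<dots> \<le> \<rho> / (1 - \<rho>) + real k ^ n * exp (- (?\<eta> * (real n)\<^sup>2) / (8 * \<tau>))"
    using near_sum far_sum by (rule add_mono)
  finally show "prob (\<Union>x\<in>?\<Omega> - equiv_class col k n y. Bad M x)
      \<le> \<rho> / (1 - \<rho>) + real k ^ n * exp (- (?\<eta> * (real n)\<^sup>2) / (8 * \<tau>))" .
qed

section \<open>The noise level below the threshold\<close>

text \<open>Recovery is reduced to comparisons of objectives, whichever minimizer is selected in
  case of ties. A minimizer is never worse than \<open>y\<close>, so it is equivalent to
  \<open>y\<close> if all inequivalent assignments are strictly worse. Assignments equivalent to
  \<open>y\<close> share its objective, so one strictly better feasible assignment rules them all
  out.\<close>

lemma least_squares_estimator_events:
  assumes est: "is_least_squares_estimator M n R T z" and T: "T \<subseteq> assignments col k n" "y \<in> T"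
  shows "{\<omega> \<in> space M. z \<omega> \<in> equiv_class col k n y} \<in> sets M"
    and "space M - (\<Union>x\<in>assignments col k n - equiv_class col k n y.
             {\<omega> \<in> space M. ls_objective n (R \<omega>) x \<le> ls_objective n (R \<omega>) y})
           \<subseteq> {\<omega> \<in> space M. z \<omega> \<in> equiv_class col k n y}"
    and "{\<omega> \<in> space M. \<exists>x\<in>T. ls_objective n (R \<omega>) x < ls_objective n (R \<omega>) y}
           \<subseteq> space M - {\<omega> \<in> space M. z \<omega> \<in> equiv_class col k n y}"
proof -
  have z: "z \<in> measurable M (count_space T)"
    and min: "\<And>\<omega> x. \<omega> \<in> space M \<Longrightarrow> x \<in> T \<Longrightarrow> \<not> ls_objective n (R \<omega>) x < ls_objective n (R \<omega>) (z \<omega>)"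
    and zT: "\<And>\<omega>. \<omega> \<in> space M \<Longrightarrow> z \<omega> \<in> T"
    using est by (auto simp: is_least_squares_estimator_def is_arg_min_def ls_objective_def)
  have "z -` (T \<inter> equiv_class col k n y) \<inter> space M \<in> sets M"
    using z by (rule measurable_sets) simp
  also have "z -` (T \<inter> equiv_class col k n y) \<inter> space M = {\<omega> \<in> space M. z \<omega> \<in> equiv_class col k n y}"
    using zT by auto
  finally show "{\<omega> \<in> space M. z \<omega> \<in> equiv_class col k n y} \<in> sets M" .
  show "space M - (\<Union>x\<in>assignments col k n - equiv_class col k n y.
             {\<omega> \<in> space M. ls_objective n (R \<omega>) x \<le> ls_objective n (R \<omega>) y})
           \<subseteq> {\<omega> \<in> space M. z \<omega> \<in> equiv_class col k n y}"
    using min[OF _ T(2)] zT T(1) by (fastforce simp: not_less)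
  have "ls_objective n r x = ls_objective n r y" if "x \<in> equiv_class col k n y" for x r
  proof -
    have "K_mat x i j = K_mat y i j" if "i \<in> {1..n}" "j \<in> {1..n}" for i j
      using that \<open>x \<in> equiv_class col k n y\<close> by (simp add: K_mat_def equiv_class_def)
    then show ?thesis unfolding ls_objective_eq_sum by (intro sum.cong) auto
  qed
  then show "{\<omega> \<in> space M. \<exists>x\<in>T. ls_objective n (R \<omega>) x < ls_objective n (R \<omega>) y}
           \<subseteq> space M - {\<omega> \<in> space M. z \<omega> \<in> equiv_class col k n y}"
    using min by fastforce
qed

text \<open>Since \<open>m \<le> \<delta> * S / 2\<close>, one has \<open>S - m \<ge> (1 - \<delta>
  / 2) * S \<ge> (1 + \<delta> / 2) * ((1 - \<delta>) * S)\<close>. The exponent is therefore at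
  least \<open>m * (1 + \<delta> / 2) * ln n\<close>, which beats the entropy factor
  \<open>n ^ m\<close> with \<open>\<delta> / 2\<close> to spare.\<close>

lemma near_union_bound:
  fixes n m k :: nat and S \<delta> c :: real
  assumes n: "n \<ge> 2" and \<delta>: "0 < \<delta>" "\<delta> < 1" and c: "c > 0" and S: "2 * c * n \<le> S" 
    and m: "real m \<le> \<delta> * c * n"
  defines "\<tau> \<equiv> (1 - \<delta>) * S / (4 * ln n)"
  shows "real (n * k) ^ m * exp (- (m * (S - m)) / (4 * \<tau>)) \<le> (k * real n powr (- \<delta> / 2)) ^ m"
proof -
  have l: "ln n > 0" using n by simp
  have Spos: "S > 0" using S c n by (smt (verit) mult_pos_pos of_nat_0_less_iff zero_less_numeral less_le_trans pos2)
  have "(1 + \<delta> / 2) * ((1 - \<delta>) * S) \<le> (1 - \<delta> / 2) * S"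
    using \<delta> Spos by (simp add: algebra_simps)
  also have "\<dots> \<le> S - m"
  proof -
    have "\<delta> * (2 * c * n) \<le> \<delta> * S" using S \<delta> by (intro mult_left_mono) auto
    then show ?thesis using m by (simp add: algebra_simps)
  qed
  finally have "(1 + \<delta> / 2) * ((1 - \<delta>) * S) \<le> S - m" .
  then have "(1 + \<delta> / 2) * ln n \<le> (S - m) / ((1 - \<delta>) * S) * ln n"
    using \<delta> Spos l by (intro mult_right_mono) (auto simp: pos_le_divide_eq)
  also have "\<dots> = (S - m) / (4 * \<tau>)" using l Spos \<delta> by (simp add: \<tau>_def field_simps)
  finally have "m * ((1 + \<delta> / 2) * ln n) \<le> m * ((S - m) / (4 * \<tau>))" by (intro mult_left_mono) auto
  then have "exp (- (m * (S - m)) / (4 * \<tau>)) \<le> exp (- (m * ((1 + \<delta> / 2) * ln n)))" by simp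
  also have "\<dots> = (real n powr (- (1 + \<delta> / 2))) ^ m"
    using n by (simp add: powr_def algebra_simps flip: exp_of_nat_mult)
  finally have "real (n * k) ^ m * exp (- (m * (S - m)) / (4 * \<tau>))
      \<le> real (n * k) ^ m * (real n powr (- (1 + \<delta> / 2))) ^ m"
    by (intro mult_left_mono) auto
  also have "\<dots> = (k * (real n * real n powr (- (1 + \<delta> / 2)))) ^ m"
    by (simp add: power_mult_distrib mult_ac)
  also have "real n * real n powr (- (1 + \<delta> / 2)) = real n powr (- \<delta> / 2)"
    using n powr_add[of "real n" 1 "- (1 + \<delta> / 2)"] by simp
  finally show ?thesis .
qed

text \<open>As \<open>S \<le> n\<close>, the value \<tau> is at most \<open>n / (4 * ln n)\<close>,
  so the exponent is of order \<open>n * ln n\<close> and outweighs the \<open>k ^ n\<close>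
  assignments.\<close>

lemma far_union_bound:
  fixes n k :: nat and S \<delta> \<eta> :: real
  assumes n: "n \<ge> 2" and \<delta>: "0 < \<delta>" "\<delta> < 1" and S: "0 < S" "S \<le> n" and \<eta>: "\<eta> \<ge> 0"
  defines "\<tau> \<equiv> (1 - \<delta>) * S / (4 * ln n)"
  shows "exp (- (\<eta> * (real n)\<^sup>2) / (8 * \<tau>)) \<le> exp (- (\<eta> * n * ln n / 2))"
proof -
  have l: "ln n > 0" using n by simp
  have "(1 - \<delta>) * S \<le> 1 * real n" using \<delta> S by (intro mult_mono) auto
  then have "\<eta> * (real n)\<^sup>2 * ln n / (2 * real n) \<le> \<eta> * (real n)\<^sup>2 * ln n / (2 * ((1 - \<delta>) * S))"
    using S \<delta> l n \<eta> by (intro divide_left_mono) auto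
  also have "\<dots> = (\<eta> * (real n)\<^sup>2) / (8 * \<tau>)" by (simp add: \<tau>_def)
  also have "\<eta> * (real n)\<^sup>2 * ln n / (2 * real n) = \<eta> * n * ln n / 2"
    using n by (simp add: power2_eq_square)
  finally show ?thesis by simp
qed

lemma union_bounds_tendsto_0:
  fixes K \<delta> \<eta> :: real
  assumes "K > 0" "\<delta> > 0" "\<eta> > 0"
  shows "(\<lambda>n. K * real n powr (- \<delta> / 2)) \<longlonglongrightarrow> 0"
    and "(\<lambda>n. K * real n powr (- \<delta> / 2) / (1 - K * real n powr (- \<delta> / 2)) +
           K ^ n * exp (- (\<eta> * n * ln n / 2))) \<longlonglongrightarrow> 0"
proof -
  show 1: "(\<lambda>n. K * real n powr (- \<delta> / 2)) \<longlonglongrightarrow> 0" using assms by real_asymp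
  have lim: "(\<lambda>n. exp (n * L - \<eta> * n * ln n / 2)) \<longlonglongrightarrow> 0" for L :: real
    using assms by real_asymp
  have eq: "exp (n * ln K - \<eta> * n * ln n / 2) = K ^ n * exp (- (\<eta> * n * ln n / 2))" for n :: nat
  proof -
    have "exp (n * ln K - \<eta> * n * ln n / 2) = exp (n * ln K) * exp (- (\<eta> * n * ln n / 2))"
      by (simp flip: exp_add)
    also have "exp (n * ln K) = K ^ n" using assms by (simp add: exp_of_nat_mult)
    finally show ?thesis .
  qed
  have 2: "(\<lambda>n. K ^ n * exp (- (\<eta> * n * ln n / 2))) \<longlonglongrightarrow> 0"
    using lim[of "ln K"] unfolding eq .
  show "(\<lambda>n. K * real n powr (- \<delta> / 2) / (1 - K * real n powr (- \<delta> / 2)) +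
           K ^ n * exp (- (\<eta> * n * ln n / 2))) \<longlonglongrightarrow> 0"
    using tendsto_add[OF tendsto_divide[OF 1 tendsto_diff[OF tendsto_const 1, of 1]] 2] by simp
qed

section \<open>Swaps of two vertices\<close>

text \<open>The transposition permutes \<open>{1..n}\<close> and hence carries color classes to
  color classes of the same size; outside, the value \<open>undefined\<close> is kept.\<close>

lemma swap_assignment:
  fixes n :: nat and v w :: nat
  defines "x y \<equiv> y \<circ> Transposition.transpose v w"
  assumes y: "y \<in> assignments_with_sizes col k n s" and v: "v \<in> {1..n}" "w \<in> {1..n}"
  shows "x y \<in> assignments_with_sizes col k n s"
proof -
  let ?t = "Transposition.transpose v w"
  have t: "?t u \<in> {1..n} \<longleftrightarrow> u \<in> {1..n}" for u
    using v by (auto simp: Transposition.transpose_def)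
  have out: "?t u = u" if "u \<notin> {1..n}" for u using that v by (auto simp: Transposition.transpose_def)
  have "x y \<in> assignments col k n"
  proof -
    have Y: "y \<in> {1..n} \<rightarrow>\<^sub>E palette col k"
      using y by (simp add: assignments_with_sizes_def assignments_def)
    show ?thesis unfolding assignments_def
    proof (rule PiE_I)
      fix u assume "u \<in> {1..n}"
      then show "x y u \<in> palette col k" using t PiE_mem[OF Y] unfolding x_def comp_def by blast
    next
      fix u assume u: "u \<notin> {1..n}"
      then show "x y u = undefined" using out[OF u] PiE_arb[OF Y u] by (simp add: x_def)
    qed
  qed
  moreover have "color_count n (x y) a = color_count n y a" for a
  proof -
    have "x y -` {a} \<inter> {1..n} = ?t ` (y -` {a} \<inter> {1..n})"
    proof (intro set_eqI iffI)
      fix u assume "u \<in> x y -` {a} \<inter> {1..n}"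
      then have "?t u \<in> y -` {a} \<inter> {1..n}" using t[of u] by (simp add: x_def)
      then have "?t (?t u) \<in> ?t ` (y -` {a} \<inter> {1..n})" by (rule imageI)
      then show "u \<in> ?t ` (y -` {a} \<inter> {1..n})" by simp
    next
      fix u assume "u \<in> ?t ` (y -` {a} \<inter> {1..n})"
      then obtain u' where "u = ?t u'" "u' \<in> y -` {a} \<inter> {1..n}" by blast
      then show "u \<in> x y -` {a} \<inter> {1..n}" using t[of u'] by (simp add: x_def)
    qed
    moreover have "inj_on ?t (y -` {a} \<inter> {1..n})" by (rule inj_on_inverseI[of _ ?t]) simp
    ultimately show ?thesis unfolding color_count_def by (simp only: card_image)
  qed
  ultimately show ?thesis using y by (simp add: assignments_with_sizes_def)
qed

text \<open>Inside \<open>{v, w}\<close> the two colors are merely exchanged, and outside nothing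
  changes. A pair with exactly one index in \<open>{v, w}\<close> changes precisely when its other
  vertex lies in one of the two classes.\<close>

lemma differing_pairs_swap:
  fixes n :: nat and y :: "nat \<Rightarrow> real"
  assumes v: "v \<in> {1..n}" "w \<in> {1..n}" and ne: "y v \<noteq> y w"
  defines "U \<equiv> {u \<in> {1..n}. y u = y v \<or> y u = y w} - {v, w}"
  shows "differing_pairs n (y \<circ> Transposition.transpose v w) y = {v, w} \<times> U \<union> U \<times> {v, w}"
proof -
  define x where "x = y \<circ> Transposition.transpose v w"
  have x: "x v = y w" "x w = y v" "\<And>u. u \<noteq> v \<Longrightarrow> u \<noteq> w \<Longrightarrow> x u = y u" 
    by (auto simp: x_def Transposition.transpose_def)
  have "(i, j) \<in> differing_pairs n x y \<longleftrightarrow> (i, j) \<in> {v, w} \<times> U \<union> U \<times> {v, w}" for i j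
  proof -
    consider "i \<in> {v, w}" "j \<in> {v, w}" | "i \<in> {v, w}" "j \<notin> {v, w}" 
      | "i \<notin> {v, w}" "j \<in> {v, w}" | "i \<notin> {v, w}" "j \<notin> {v, w}" by blast
    then show ?thesis
    proof cases
      case 1
      then show ?thesis using x v ne unfolding differing_pairs_iff U_def by auto
    next
      case 2
      have i: "i \<in> {1..n}" using 2 v by blast
      have "x j = y j" using 2 x by simp
      then have "(i, j) \<in> differing_pairs n x y \<longleftrightarrow> j \<in> {1..n} \<and> (x i = y j) \<noteq> (y i = y j)"
        using i unfolding differing_pairs_iff by simp
      also have "(x i = y j) \<noteq> (y i = y j) \<longleftrightarrow> y j = y v \<or> y j = y w"
        using 2(1) x(1,2) ne by (metis insertE singletonD)
      finally show ?thesis using 2 unfolding U_def by blast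
    next
      case 3
      have j: "j \<in> {1..n}" using 3 v by blast
      have "x i = y i" using 3 x by simp
      then have "(i, j) \<in> differing_pairs n x y \<longleftrightarrow> i \<in> {1..n} \<and> (x j = y i) \<noteq> (y j = y i)"
        using j unfolding differing_pairs_iff by (simp add: eq_commute[of "x j" "y i"] eq_commute[of "y j" "y i"])
      also have "(x j = y i) \<noteq> (y j = y i) \<longleftrightarrow> y i = y v \<or> y i = y w"
        using 3(2) x(1,2) ne by (metis insertE singletonD)
      finally show ?thesis using 3 unfolding U_def by blast
    next
      case 4
      then have "x i = y i" "x j = y j" using x by simp_all
      then show ?thesis using 4 unfolding differing_pairs_iff by auto
    qed
  qed
  then show ?thesis unfolding x_def[symmetric] by (intro set_eqI) (metis surj_pair)
qed

text \<open>The differing pairs of a swap of \<open>v \<in> HA\<close> and \<open>w \<in> HB\<close> split into the stars joining \<open>v\<close>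
  and \<open>w\<close> to the vertices of the two classes outside \<open>HA \<union> HB\<close>, which are disjoint for distinct
  vertices and hence carry independent noise, and a small remainder inside \<open>HA \<union> HB\<close>.\<close>

lemma prob_better_swap_ge:
  fixes n k h :: nat and W :: "nat \<Rightarrow> nat \<Rightarrow> 'w \<Rightarrow> real" and y :: "nat \<Rightarrow> real" and \<sigma> t r :: real
  defines "R \<equiv> observation y \<sigma> W"
  assumes M: "prob_space M" and W: "std_gaussian_matrix M n W"
    and y: "y \<in> assignments_with_sizes col k n s" and ab: "a \<noteq> b"
  defines "A \<equiv> {u \<in> {1..n}. y u = a}" and "B \<equiv> {u \<in> {1..n}. y u = b}"
  assumes h: "h \<ge> 2" "h \<le> card A" "h \<le> card B" and S: "card A + card B > 2 * h"
    and t: "t \<ge> 0" and r: "r \<ge> 0"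
    and gain: "2 * real (card A + card B) \<le> \<bar>\<sigma>\<bar> * (2 * t - r)"
  shows "{\<omega> \<in> space M. \<exists>x\<in>assignments_with_sizes col k n s.
             ls_objective n (R \<omega>) x < ls_objective n (R \<omega>) y} \<in> sets M" (is "?G \<in> _")
    and "measure M {\<omega> \<in> space M. \<exists>x\<in>assignments_with_sizes col k n s.
             ls_objective n (R \<omega>) x < ls_objective n (R \<omega>) y}
      \<ge> 1 - 2 * exp (- real h * (exp (- (t / sqrt (2 * (card A + card B - 2 * h)) + 1)\<^sup>2 / 2) / sqrt (2 * pi)))
          - real h ^ 2 * exp (- r\<^sup>2 / (16 * h))"
proof -
  let ?T = "assignments_with_sizes col k n s"
  let ?S = "card A + card B"
  define g where "g i j = (if \<sigma> < 0 then - 1 else 1) * (1 - 2 * K_mat y i j)" for i j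
  define X where "X = (\<lambda>(i, j) \<omega>. g i j * W i j \<omega>)"
  interpret iid_std_normal M X "{1..n} \<times> {1..n}"
    unfolding X_def using M W by (intro iid_std_normal_signed_matrix) (auto simp: g_def K_mat_def)
  let ?X = "\<lambda>P \<omega>. \<Sum>p\<in>P. X p \<omega>"
  have diff: "ls_objective n (R \<omega>) x - ls_objective n (R \<omega>) y
      = card (differing_pairs n x y) - 2 * \<bar>\<sigma>\<bar> * ?X (differing_pairs n x y) \<omega>" for x \<omega>
    unfolding R_def ls_objective_diff X_def g_def by (simp add: split_def)
  have G_eq: "?G = (\<Union>x\<in>?T. {\<omega> \<in> space M.
      card (differing_pairs n x y) - 2 * \<bar>\<sigma>\<bar> * ?X (differing_pairs n x y) \<omega> < 0})"
    unfolding diff[symmetric] by auto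
  have finT: "finite ?T"
    using finite_assignments by (rule finite_subset[rotated]) (auto simp: assignments_with_sizes_def)
  have measX: "?X P \<in> borel_measurable M" if "P \<subseteq> {1..n} \<times> {1..n}" for P
    using that by (rule sum_measurable)
  have DD: "differing_pairs n x y \<subseteq> {1..n} \<times> {1..n}" for x by (auto simp: differing_pairs_def)
  show G: "?G \<in> events"
    unfolding G_eq
  proof (intro sets.finite_UN finT)
    fix x
    note [measurable] = measX[OF DD[of x]]
    show "{\<omega> \<in> space M. card (differing_pairs n x y)
        - 2 * \<bar>\<sigma>\<bar> * ?X (differing_pairs n x y) \<omega> < 0} \<in> events"
      by measurable
  qed
  obtain HA where HA: "HA \<subseteq> A" "card HA = h" "finite HA" using h(2) by (metis obtain_subset_with_card_n)
  obtain HB where HB: "HB \<subseteq> B" "card HB = h" "finite HB" using h(3) by (metis obtain_subset_with_card_n)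
  have AB: "A \<inter> B = {}" "finite A" "finite B" "A \<subseteq> {1..n}" "B \<subseteq> {1..n}"
    using ab by (auto simp: A_def B_def)
  define H where "H = HA \<union> HB"
  define C where "C = (A \<union> B) - H"
  define N where "N v = {v} \<times> C \<union> C \<times> {v}" for v
  define Q where "Q v w = {v, w} \<times> (H - {v, w}) \<union> (H - {v, w}) \<times> {v, w}" for v w
  have cH: "card H = 2 * h" "finite H" "H \<subseteq> A \<union> B"
    using HA HB AB unfolding H_def by (auto intro!: card_Un_disjoint[THEN trans])
  have cC: "card C = ?S - 2 * h" "finite C"
    unfolding C_def using cH AB by (simp_all add: card_Diff_subset card_Un_disjoint)
  have NI: "N v \<subseteq> {1..n} \<times> {1..n}" "card (N v) = 2 * (?S - 2 * h)" if "v \<in> H" for v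
  proof -
    show "N v \<subseteq> {1..n} \<times> {1..n}" using that cH AB by (auto simp: N_def C_def)
    have "v \<notin> C" using that by (simp add: C_def)
    then have "card (N v) = card ({v} \<times> C) + card (C \<times> {v})"
      unfolding N_def using cC by (intro card_Un_disjoint) auto
    then show "card (N v) = 2 * (?S - 2 * h)" using cC by (simp add: card_cartesian_product)
  qed
  have disjN: "disjoint_family_on N H"
    by (auto simp: disjoint_family_on_def N_def C_def)
  let ?p = "exp (- (t / sqrt (2 * (?S - 2 * h)) + 1)\<^sup>2 / 2) / sqrt (2 * pi)"
  define EV where "EV V = {\<omega> \<in> space M. \<forall>v\<in>V. ?X (N v) \<omega> < t}" for V
  have EV: "prob (EV V) \<le> exp (- real h * ?p)" if "V \<subseteq> H" "card V = h" for V
  proof -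
    have "finite V" using that cH finite_subset by blast
    moreover have "disjoint_family_on N V" using disjN that by (auto simp: disjoint_family_on_def)
    ultimately have "prob (EV V) \<le> exp (- real (card V) * (exp (- (t / sqrt (real (2 * (?S - 2 * h))) + 1)\<^sup>2 / 2) / sqrt (2 * pi)))"
      unfolding EV_def using that NI S t by (intro prob_all_sums_less) auto
    then show ?thesis using that by simp
  qed
  have EVm: "EV V \<in> events" if "V \<subseteq> H" for V
    unfolding EV_def
  proof (rule sets.sets_Collect_finite_All)
    show "finite V" using that cH finite_subset by blast
    fix v assume "v \<in> V"
    then have [measurable]: "?X (N v) \<in> borel_measurable M" using that NI by (intro measX) auto
    show "{\<omega> \<in> space M. ?X (N v) \<omega> < t} \<in> events" by measurable
  qed
  define F where "F = (\<lambda>(v, w). {\<omega> \<in> space M. ?X (Q v w) \<omega> \<le> - r})"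
  have QI: "Q v w \<subseteq> {1..n} \<times> {1..n}" if "v \<in> HA" "w \<in> HB" for v w
    using that HA HB AB cH by (auto simp: Q_def)
  have Fm: "F p \<in> events" if "p \<in> HA \<times> HB" for p
  proof -
    obtain v w where p: "p = (v, w)" "v \<in> HA" "w \<in> HB" using \<open>p \<in> HA \<times> HB\<close> by auto
    note [measurable] = measX[OF QI[OF p(2,3)]]
    show ?thesis unfolding p F_def split by measurable
  qed
  have F: "prob (F p) \<le> exp (- r\<^sup>2 / (16 * h))" if "p \<in> HA \<times> HB" for p
  proof -
    obtain v w where p: "p = (v, w)" "v \<in> HA" "w \<in> HB" using \<open>p \<in> HA \<times> HB\<close> by auto
    have vw: "v \<noteq> w" using p HA HB AB by auto
    \<comment> \<open>Twice this number of vertices, in both orders, gives at most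
      \<open>8 * h\<close> entries of \<open>Q v w\<close>, whence the \<open>16 * h\<close> in the
      exponent; \<open>h \<ge> 2\<close> makes the remainder nonempty.\<close>
    have cHvw: "card (H - {v, w}) = 2 * h - 2"
      using vw p cH unfolding H_def by (subst card_Diff_subset) auto
    have finQ: "finite (Q v w)" using cH by (simp add: Q_def)
    have "card (Q v w) \<le> card ({v, w} \<times> (H - {v, w})) + card ((H - {v, w}) \<times> {v, w})"
      unfolding Q_def by (rule card_Un_le)
    also have "\<dots> = 4 * (2 * h - 2)" using vw cHvw by (simp add: card_cartesian_product)
    finally have cQ: "card (Q v w) \<le> 8 * h" by simp
    have neQ: "Q v w \<noteq> {}"
    proof -
      have "card (H - {v, w}) \<noteq> 0" using cHvw h(1) by simp
      then have "H - {v, w} \<noteq> {}" by (metis card.empty)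
      then show ?thesis by (auto simp: Q_def)
    qed
    have cQ0: "card (Q v w) > 0" using neQ finQ by (simp add: card_gt_0_iff)
    have "prob (F p) \<le> exp (- r\<^sup>2 / (2 * card (Q v w)))"
      unfolding p F_def split using QI[OF p(2,3)] neQ r by (rule prob_sum_le_upper)
    also have "\<dots> \<le> exp (- r\<^sup>2 / (16 * h))"
      using cQ cQ0 by (simp add: frac_le)
    finally show ?thesis .
  qed
  \<comment> \<open>Outside these events some \<open>v\<close> in \<open>HA\<close> and some
    \<open>w\<close> in \<open>HB\<close> both have star noise at least \<open>t\<close>, and their
    remainder exceeds \<open>- r\<close>. The total noise is then at least \<open>2 * t - r\<close>,
    which by \<open>gain\<close> pays for the swap.\<close>
  have "space M - ?G \<subseteq> (EV HA \<union> EV HB) \<union> (\<Union>p\<in>HA \<times> HB. F p)"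
  proof (rule subsetI, rule ccontr)
    fix \<omega> assume \<omega>: "\<omega> \<in> space M - ?G" and "\<omega> \<notin> (EV HA \<union> EV HB) \<union> (\<Union>p\<in>HA \<times> HB. F p)"
    then obtain v w where vw: "v \<in> HA" "w \<in> HB" "?X (N v) \<omega> \<ge> t" "?X (N w) \<omega> \<ge> t" 
        and rem: "?X (Q v w) \<omega> > - r"
      by (fastforce simp: EV_def F_def not_less not_le)
    let ?x = "y \<circ> Transposition.transpose v w"
    let ?D = "differing_pairs n ?x y"
    have v: "v \<in> {1..n}" "w \<in> {1..n}" "y v = a" "y w = b" "v \<noteq> w" "v \<in> H" "w \<in> H"
      using vw HA HB ab by (auto simp: A_def B_def H_def)
    have "{u \<in> {1..n}. y u = y v \<or> y u = y w} - {v, w} = C \<union> (H - {v, w})"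
      using v cH(3) by (auto simp: C_def A_def B_def)
    then have D: "?D = {v, w} \<times> (C \<union> (H - {v, w})) \<union> (C \<union> (H - {v, w})) \<times> {v, w}"
      using differing_pairs_swap[of v n w y] v ab by simp
    have D2: "?D = (N v \<union> N w) \<union> Q v w" unfolding D N_def Q_def by blast
    have fin: "finite (N v)" "finite (N w)" "finite (Q v w)"
      using cC cH by (auto simp: N_def Q_def)
    have nC: "v \<notin> C" "w \<notin> C" using v by (auto simp: C_def)
    have dis: "N v \<inter> N w = {}" "(N v \<union> N w) \<inter> Q v w = {}"
      using nC v by (auto simp: N_def Q_def C_def)
    have "?X ?D \<omega> = ?X (N v) \<omega> + ?X (N w) \<omega> + ?X (Q v w) \<omega>"
      unfolding D2 using fin dis by (simp add: sum.union_disjoint)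
    then have X: "?X ?D \<omega> \<ge> 2 * t - r" using vw rem by simp
    \<comment> \<open>At least \<open>v\<close> is missing from the two classes. This strict
      inequality makes the swap strictly better although \<open>gain\<close> is not strict.\<close>
    have cU: "card (C \<union> (H - {v, w})) < ?S"
    proof -
      have "C \<union> (H - {v, w}) \<subseteq> (A \<union> B) - {v}" using cH nC by (auto simp: C_def)
      then have "card (C \<union> (H - {v, w})) \<le> card ((A \<union> B) - {v})" using AB by (intro card_mono) auto
      also have "\<dots> = ?S - 1" using v AB by (simp add: card_Un_disjoint A_def B_def)
      finally show ?thesis using S by simp
    qed
    have "card ?D \<le> card ({v, w} \<times> (C \<union> (H - {v, w}))) + card ((C \<union> (H - {v, w})) \<times> {v, w})"
      unfolding D by (rule card_Un_le)
    also have "\<dots> = 4 * card (C \<union> (H - {v, w}))" using v by (simp add: card_cartesian_product)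
    also have "\<dots> < 4 * ?S" using cU by simp
    finally have "real (card ?D) < 2 * (2 * real ?S)" by linarith
    also have "\<dots> \<le> 2 * (\<bar>\<sigma>\<bar> * (2 * t - r))" using gain by simp
    also have "\<dots> \<le> 2 * \<bar>\<sigma>\<bar> * ?X ?D \<omega>" using X by (simp add: mult_left_mono)
    finally have "ls_objective n (R \<omega>) ?x < ls_objective n (R \<omega>) y" using diff[of \<omega> ?x] by simp
    moreover have "?x \<in> ?T" using y v by (intro swap_assignment) auto
    ultimately show False using \<omega> by blast
  qed
  then have "prob (space M - ?G) \<le> prob ((EV HA \<union> EV HB) \<union> (\<Union>p\<in>HA \<times> HB. F p))"
    using EVm Fm HA HB by (intro finite_measure_mono) (auto simp: H_def intro!: sets.Un sets.finite_UN)
  also have "\<dots> \<le> prob (EV HA \<union> EV HB) + prob (\<Union>p\<in>HA \<times> HB. F p)"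
    using EVm Fm HA HB by (intro measure_Un_le sets.Un sets.finite_UN) (auto simp: H_def)
  also have "\<dots> \<le> (prob (EV HA) + prob (EV HB)) + (\<Sum>p\<in>HA \<times> HB. prob (F p))"
    using EVm Fm HA HB
    by (intro add_mono measure_Un_le finite_measure_subadditive_finite) (auto simp: H_def)
  also have "\<dots> \<le> (exp (- real h * ?p) + exp (- real h * ?p)) + (\<Sum>p\<in>HA \<times> HB. exp (- r\<^sup>2 / (16 * h)))"
    using HA HB by (intro add_mono EV sum_mono F) (auto simp: H_def)
  also have "(\<Sum>p\<in>HA \<times> HB. exp (- r\<^sup>2 / (16 * h))) = real h ^ 2 * exp (- r\<^sup>2 / (16 * h))"
    using HA HB by (simp add: power2_eq_square)
  finally have "prob (space M - ?G) \<le> 2 * exp (- real h * ?p) + real h ^ 2 * exp (- r\<^sup>2 / (16 * h))"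
    by simp
  then show "prob ?G \<ge> 1 - 2 * exp (- real h * ?p) - real h ^ 2 * exp (- r\<^sup>2 / (16 * h))"
    using prob_compl[OF G] by linarith
qed

section \<open>The noise level above the threshold\<close>

text \<open>Here \<open>b\<close> near 1 measures the slack above the threshold. Since
  \<open>2 * t - r = 4 * b ^ 3 * sqrt (S * ln n)\<close>, the factor \<open>b ^ 6\<close> in the
  noise assumption gives exactly the required gain. Small \<kappa> makes \<open>2 * h\<close> at
  most \<open>(1 - b) * S\<close>, so a star keeps variance at least \<open>2 * b * S\<close>, and
  its normalized threshold stays below \<open>sqrt (2 * ln n)\<close> by the factor
  \<open>b\<close>.\<close>

lemma swap_parameters:
  fixes n h S :: nat and b c \<sigma> \<kappa> :: real
  assumes b: "0 < b" "b < 1" and c: "c > 0" and n: "n \<ge> 2" and S: "2 * c * n \<le> S"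
    and \<sigma>: "real S \<le> b ^ 6 * (4 * ln n * \<sigma>\<^sup>2)"
    and \<kappa>: "\<kappa> \<le> c * (1 - b)" "\<kappa> \<le> 2 / 3 * c * (1 - b)\<^sup>2 * b ^ 4" and h: "h \<ge> 1" "h \<le> \<kappa> * n"
  defines "t \<equiv> 2 * b\<^sup>2 * sqrt (S * ln n)"
    and "r \<equiv> 4 * (1 - b) * b\<^sup>2 * sqrt (S * ln n)"
  shows "2 * h < S" 
    and "2 * real S \<le> \<bar>\<sigma>\<bar> * (2 * t - r)"
    and "t / sqrt (2 * (S - 2 * h)) \<le> b * sqrt (2 * ln n)"
    and "3 * ln n \<le> r\<^sup>2 / (16 * h)"
proof -
  have l: "ln n > 0" using n by simp
  have cn: "c * n > 0" using c n by simp
  have S0: "real S > 0" using S cn by linarith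
  have "\<kappa> * n \<le> c * (1 - b) * n" using \<kappa>(1) by (intro mult_right_mono) auto
  also have "\<dots> = (1 - b) * (c * n)" by simp
  also have "\<dots> \<le> (1 - b) * (S / 2)" using S b by (intro mult_left_mono) auto
  finally have h2: "2 * real h \<le> (1 - b) * S" using h by (simp add: field_simps)
  also have "\<dots> < 1 * real S" using b S0 by (intro mult_strict_right_mono) auto
  finally show hS: "2 * h < S" by simp
  have "(2 * real S)\<^sup>2 = 4 * real S * real S" by (simp add: power2_eq_square)
  also have "\<dots> \<le> 4 * real S * (b ^ 6 * (4 * ln n * \<sigma>\<^sup>2))" using \<sigma> by (intro mult_left_mono) auto
  also have "\<dots> = (\<bar>\<sigma>\<bar> * (4 * b ^ 3 * sqrt (S * ln n)))\<^sup>2"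
    using l by (simp add: power_mult_distrib flip: power_mult)
  finally have "2 * real S \<le> \<bar>\<sigma>\<bar> * (4 * b ^ 3 * sqrt (S * ln n))"
    by (rule power2_le_imp_le) (use b l in auto)
  also have "4 * b ^ 3 * sqrt (S * ln n) = 2 * t - r"
    by (simp add: t_def r_def power2_eq_square power3_eq_cube algebra_simps)
  finally show "2 * real S \<le> \<bar>\<sigma>\<bar> * (2 * t - r)" .
  have "b * S \<le> real (S - 2 * h)" using h2 hS by (simp add: of_nat_diff algebra_simps)
  then have "sqrt (2 * (b * S)) \<le> sqrt (2 * (S - 2 * h))" by simp
  moreover have "t \<le> b * sqrt (2 * ln n) * sqrt (2 * (b * S))"
  proof -
    have "b * sqrt (2 * ln n) * sqrt (2 * (b * S)) = 2 * b * (sqrt b * sqrt (S * ln n))"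
      using l b by (simp add: real_sqrt_mult)
    moreover have "b \<le> sqrt b" using b by (intro real_le_rsqrt) (simp add: power2_eq_square)
    ultimately show ?thesis unfolding t_def power2_eq_square using b l
      by (simp add: mult_right_mono)
  qed
  ultimately have "t \<le> b * sqrt (2 * ln n) * sqrt (2 * (S - 2 * h))"
    using b l by (meson mult_left_mono mult_nonneg_nonneg order_trans less_imp_le real_sqrt_ge_zero zero_le_numeral)
  then show "t / sqrt (2 * (S - 2 * h)) \<le> b * sqrt (2 * ln n)"
    using hS by (simp add: pos_divide_le_eq)
  \<comment> \<open>The second bound on \<kappa> is the one for which \<open>48 * h * ln n\<close>
    does not exceed \<open>r\<^sup>2 = 16 * (1 - b)\<^sup>2 * b ^ 4 * S * ln n\<close>.\<close>
  have "3 * ln n * (16 * real h) \<le> 3 * ln n * (16 * ((2 / 3 * c * (1 - b)\<^sup>2 * b ^ 4) * n))"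
    using l h \<kappa>(2) mult_right_mono[OF \<kappa>(2), of "real n"] by (intro mult_left_mono) auto
  also have "\<dots> = 16 * ln n * (1 - b)\<^sup>2 * b ^ 4 * (2 * c * n)" by simp
  also have "\<dots> \<le> 16 * ln n * (1 - b)\<^sup>2 * b ^ 4 * S" using S l b by (intro mult_left_mono) auto
  also have "\<dots> = r\<^sup>2"
    using l unfolding r_def power_mult_distrib by (simp flip: power_mult)
  finally show "3 * ln n \<le> r\<^sup>2 / (16 * h)" using h by (simp add: pos_le_divide_eq)
qed

text \<open>A single star succeeds with probability about \<open>n powr (- b\<^sup>2)\<close> up to
  subpolynomial factors, while linearly many stars are tried. As \<open>b < 1\<close>, the product
  is a positive power of \<open>n\<close> up to such factors and diverges.\<close>

lemma swap_bound_tendsto_0: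
  fixes b \<kappa> :: real
  assumes b: "0 < b" "b < 1" and \<kappa>: "\<kappa> > 0"
  shows "(\<lambda>n. 2 * exp (- (\<kappa> * n - 1) * (exp (- (b * sqrt (2 * ln n) + 1)\<^sup>2 / 2) / sqrt (2 * pi)))
           + 1 / real n) \<longlonglongrightarrow> 0"
proof -
  define e where "e = 1 - b\<^sup>2"
  have e: "e > 0" using b by (simp add: e_def power_less_one_iff)
  have eq: "(\<kappa> * n - 1) * (exp (- (b * sqrt (2 * ln n) + 1)\<^sup>2 / 2) / sqrt (2 * pi))
      = (\<kappa> - 1 / n) * exp (e * ln n - b * sqrt (2 * ln n) - 1 / 2) / sqrt (2 * pi)" if "n \<ge> 1" for n :: nat
  proof -
    have "- (b * sqrt (2 * ln n) + 1)\<^sup>2 / 2 = (e * ln n - b * sqrt (2 * ln n) - 1 / 2) - ln n"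
      using that by (simp add: e_def power2_eq_square algebra_simps add_divide_distrib diff_divide_distrib)
    then have "exp (- (b * sqrt (2 * ln n) + 1)\<^sup>2 / 2) = exp (e * ln n - b * sqrt (2 * ln n) - 1 / 2) / n"
      using that by (simp only: exp_diff[of _ "ln n"]) simp
    then show ?thesis using that by (simp add: field_simps)
  qed
  have "(\<lambda>n. 2 * exp (- ((\<kappa> - 1 / real n) * exp (e * ln n - b * sqrt (2 * ln n) - 1 / 2) / sqrt (2 * pi)))
           + 1 / real n) \<longlonglongrightarrow> 0"
    using e b \<kappa> by real_asymp
  moreover have "\<forall>\<^sub>F n in sequentially.
      2 * exp (- ((\<kappa> - 1 / real n) * exp (e * ln n - b * sqrt (2 * ln n) - 1 / 2) / sqrt (2 * pi))) + 1 / real n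
      = 2 * exp (- (\<kappa> * n - 1) * (exp (- (b * sqrt (2 * ln n) + 1)\<^sup>2 / 2) / sqrt (2 * pi))) + 1 / real n"
    using eventually_ge_at_top[of 1]
  proof eventually_elim
    case (elim n)
    then show ?case using eq[OF elim] by (simp only: mult_minus_left)
  qed
  ultimately show ?thesis by (rule Lim_transform_eventually)
qed

section \<open>Feasibility and the two smallest classes\<close>

lemma assignments_with_sizes_subset_min_fraction:
  assumes k: "k \<ge> 1" and s: "\<And>i. i \<in> {1..k} \<Longrightarrow> a * real n \<le> s i"
  shows "assignments_with_sizes col k n s \<subseteq> assignments_min_fraction col k n a"
proof
  fix x assume x: "x \<in> assignments_with_sizes col k n s"
  have "(MIN j\<in>{1..k}. color_count n x (col j)) \<in> (\<lambda>j. color_count n x (col j)) ` {1..k}"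
    using k by (intro Min_in) auto
  then obtain j where j: "j \<in> {1..k}" "(MIN j\<in>{1..k}. color_count n x (col j)) = color_count n x (col j)"
    by auto
  then have "a * real n \<le> real (MIN j\<in>{1..k}. color_count n x (col j))"
    using s[OF j(1)] x by (simp add: assignments_with_sizes_def)
  then show "x \<in> assignments_min_fraction col k n a"
    using x by (simp add: assignments_with_sizes_def assignments_min_fraction_def)
qed

lemma card_two_classes_ge:
  assumes y: "y \<in> assignments_with_sizes col k n s" and inj: "inj_on col {1..k}"
    and desc: "\<And>i j. 1 \<le> i \<Longrightarrow> i \<le> j \<Longrightarrow> j \<le> k \<Longrightarrow> s i \<ge> s j"
    and ab: "a \<in> palette col k" "b \<in> palette col k" "a \<noteq> b"
  shows "s k + s (k - 1) \<le> card {u \<in> {1..n}. y u = a \<or> y u = b}"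
proof -
  obtain i j where ij: "i \<in> {1..k}" "j \<in> {1..k}" "a = col i" "b = col j"
    using ab by (auto simp: palette_def)
  have "{u \<in> {1..n}. y u = a \<or> y u = b} = (y -` {a} \<inter> {1..n}) \<union> (y -` {b} \<inter> {1..n})" by auto
  moreover have "card ((y -` {a} \<inter> {1..n}) \<union> (y -` {b} \<inter> {1..n})) = color_count n y a + color_count n y b"
    unfolding color_count_def using ab by (intro card_Un_disjoint) auto
  moreover have "color_count n y a = s i" "color_count n y b = s j"
    using y ij by (auto simp: assignments_with_sizes_def)
  moreover have "s k + s (k - 1) \<le> s i + s j"
  \<comment> \<open>Of two distinct indices the smaller is at most \<open>k - 1\<close> and the
    larger at most \<open>k\<close>, and the sizes decrease along the indices.\<close>
  proof (cases "i < j")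
    case True
    then show ?thesis using desc[of j k] desc[of i "k - 1"] ij by fastforce
  next
    case False
    then have "j < i" using ij ab by (metis linorder_neqE_nat)
    then show ?thesis using desc[of i k] desc[of j "k - 1"] ij by fastforce
  qed
  ultimately show ?thesis by simp
qed

section \<open>Recovery probabilities\<close>

text \<open>The union bound runs over all inequivalent assignments, so it serves any feasible set
  \<open>T\<close> that contains \<open>y\<close>, and thus both estimators at once.\<close>

lemma prob_recovery_ge:
  fixes n k :: nat and W :: "nat \<Rightarrow> nat \<Rightarrow> 'w \<Rightarrow> real" and c \<delta> \<sigma> :: real and s :: "nat \<Rightarrow> nat"
  assumes k: "k \<ge> 2" "n \<ge> k" and inj: "inj_on col {1..k}"
    and desc: "\<And>i j. 1 \<le> i \<Longrightarrow> i \<le> j \<Longrightarrow> j \<le> k \<Longrightarrow> s i \<ge> s j"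
    and total: "(\<Sum>i=1..k. s i) = n" and c: "c > 0" "c * real n \<le> s k"
    and y: "y \<in> assignments_with_sizes col k n s"
    and M: "prob_space M" and W: "std_gaussian_matrix M n W"
    and \<delta>: "\<delta> > 0" and \<sigma>: "\<sigma>\<^sup>2 < (1 - \<delta>) * (real (s k) + real (s (k - 1))) / (4 * ln (real n))"
    and est: "is_least_squares_estimator M n (observation y \<sigma> W) T z"
    and T: "y \<in> T" "T \<subseteq> assignments col k n"
    and \<rho>: "real k * real n powr (- \<delta> / 2) < 1"
  shows "1 - (real k * real n powr (- \<delta> / 2) / (1 - real k * real n powr (- \<delta> / 2)) +
      real k ^ n * exp (- (min ((c / real k)\<^sup>2) (\<delta> * c * c / (real k)\<^sup>2) * n * ln n / 2)))
    \<le> \<P>(\<omega> in M. z \<omega> \<in> equiv_class col k n y)"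
proof -
  interpret prob_space M by fact
  let ?\<eta> = "min ((c / real k)\<^sup>2) (\<delta> * c * c / (real k)\<^sup>2)"
  let ?\<rho> = "real k * real n powr (- \<delta> / 2)"
  define S where "S = s k + s (k - 1)"
  define \<tau> where "\<tau> = (1 - \<delta>) * S / (4 * ln n)"
  have n: "n \<ge> 2" using k by simp
  then have l: "ln n > 0" by simp
  have \<sigma>\<tau>: "\<sigma>\<^sup>2 < \<tau>" using \<sigma> by (simp add: \<tau>_def S_def)
  then have \<tau>: "\<tau> > 0" using zero_le_power2[of \<sigma>] by linarith
  have "s k \<le> s (k - 1)" using k by (intro desc) auto
  then have SL: "2 * c * n \<le> S" using c(2) by (simp add: S_def)
  have "c * n > 0" using c n by simp
  then have S0: "real S > 0" using SL by linarith
  \<comment> \<open>The variance is nonnegative and strictly below \<tau>, which forces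
    \<open>1 - \<delta>\<close> to be positive.\<close>
  have \<delta>1: "\<delta> < 1" using \<tau> S0 l by (simp add: \<tau>_def zero_less_divide_iff zero_less_mult_iff)
  have "S \<le> n"
  proof -
    have "(\<Sum>i\<in>{k - 1, k}. s i) \<le> (\<Sum>i=1..k. s i)" using k by (intro sum_mono2) auto
    then show ?thesis using k total by (simp add: S_def)
  qed
  have y': "y \<in> assignments col k n" using y by (simp add: assignments_with_sizes_def)
  have sizes: "c * real n \<le> color_count n y (col i)" if "i \<in> {1..k}" for i
  proof -
    have "s k \<le> s i" using that by (intro desc) auto
    then show ?thesis using c(2) y that by (simp add: assignments_with_sizes_def)
  qed
  have pairs: "S \<le> card {u \<in> {1..n}. y u = a \<or> y u = b}"
    if "a \<in> palette col k" "b \<in> palette col k" "a \<noteq> b" for a b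
    unfolding S_def using y inj desc that by (rule card_two_classes_ge)
  let ?U = "\<Union>x\<in>assignments col k n - equiv_class col k n y.
    {\<omega> \<in> space M. ls_objective n (observation y \<sigma> W \<omega>) x \<le> ls_objective n (observation y \<sigma> W \<omega>) y}"
  have near: "real (n * k) ^ m * exp (- (m * (real S - m)) / (4 * \<tau>)) \<le> ?\<rho> ^ m"
    if "m \<le> \<delta> * c * n" for m :: nat
    unfolding \<tau>_def using n \<delta> \<delta>1 c(1) SL that by (rule near_union_bound)
  \<comment> \<open>The near range is taken with \<open>\<epsilon> = \<delta> * c\<close>, the range
    covered by \<open>near_union_bound\<close>.\<close>
  have side: "k \<ge> 1" "\<sigma>\<^sup>2 \<le> \<tau>" "0 \<le> ?\<rho>" "0 < \<delta> * c" using k \<sigma>\<tau> \<delta> c(1) by auto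
  note union = prob_better_competitor_le[OF M W y' inj side(1) c(1) sizes pairs side(2) \<tau> side(3) \<rho> side(4) near]
  have U: "?U \<in> events"
    by (rule union)
  have U': "prob ?U \<le> ?\<rho> / (1 - ?\<rho>) + real k ^ n * exp (- (?\<eta> * (real n)\<^sup>2) / (8 * \<tau>))"
    by (rule union)
  have \<eta>: "?\<eta> \<ge> 0" using \<delta> c(1) by simp
  have "real S \<le> real n" using \<open>S \<le> n\<close> by simp
  then have "exp (- (?\<eta> * (real n)\<^sup>2) / (8 * \<tau>)) \<le> exp (- (?\<eta> * n * ln n / 2))"
    unfolding \<tau>_def by (rule far_union_bound[OF n \<delta> \<delta>1 S0 _ \<eta>])
  then have "real k ^ n * exp (- (?\<eta> * (real n)\<^sup>2) / (8 * \<tau>)) \<le> real k ^ n * exp (- (?\<eta> * n * ln n / 2))"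
    by (intro mult_left_mono) auto
  then have "1 - (?\<rho> / (1 - ?\<rho>) + real k ^ n * exp (- (?\<eta> * n * ln n / 2))) \<le> prob (space M - ?U)"
    using U' prob_compl[OF U] by linarith
  also have "\<dots> \<le> prob {\<omega> \<in> space M. z \<omega> \<in> equiv_class col k n y}"
    using least_squares_estimator_events[OF est T(2,1)] by (intro finite_measure_mono) auto
  finally show ?thesis .
qed

text \<open>Every swap of \<open>y\<close> keeps the class sizes and so lies in \<open>T\<close>; a
  single swap that beats \<open>y\<close> already excludes recovery. The classes \<open>k\<close>
  and \<open>k - 1\<close> are the cheapest ones to swap between.\<close>

lemma prob_recovery_le:
  fixes n k :: nat and W :: "nat \<Rightarrow> nat \<Rightarrow> 'w \<Rightarrow> real" and b c \<sigma> \<kappa> :: real and s :: "nat \<Rightarrow> nat"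
  assumes k: "k \<ge> 2" "n \<ge> k" and inj: "inj_on col {1..k}"
    and desc: "s (k - 1) \<ge> s k" and c: "c > 0" "c * real n \<le> s k"
    and y: "y \<in> assignments_with_sizes col k n s"
    and M: "prob_space M" and W: "std_gaussian_matrix M n W"
    and b: "0 < b" "b < 1" and \<sigma>: "real (s k) + real (s (k - 1)) \<le> b ^ 6 * (4 * ln n * \<sigma>\<^sup>2)"
    and \<kappa>: "0 < \<kappa>" "\<kappa> \<le> c * (1 - b)" "\<kappa> \<le> 2 / 3 * c * (1 - b)\<^sup>2 * b ^ 4"
    and est: "is_least_squares_estimator M n (observation y \<sigma> W) T z"
    and T: "assignments_with_sizes col k n s \<subseteq> T" "T \<subseteq> assignments col k n"
    and large: "2 \<le> \<kappa> * n"
  shows "\<P>(\<omega> in M. z \<omega> \<in> equiv_class col k n y)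
    \<le> 2 * exp (- (\<kappa> * n - 1) * (exp (- (b * sqrt (2 * ln n) + 1)\<^sup>2 / 2) / sqrt (2 * pi))) + 1 / real n"
proof -
  interpret prob_space M by fact
  define S where "S = s k + s (k - 1)"
  \<comment> \<open>Linearly many candidates on each side; rounding down loses at most one, hence
    the \<open>\<kappa> * n - 1\<close> in the bound.\<close>
  define h where "h = nat \<lfloor>\<kappa> * n\<rfloor>"
  have h: "h \<ge> 2" "real h \<le> \<kappa> * n" "\<kappa> * n - 1 \<le> h"
    using large by (auto simp: h_def le_nat_iff le_floor_iff)
  have n: "n \<ge> 2" using k by simp
  then have l: "ln n > 0" by simp
  have SL: "2 * c * n \<le> S" using c(2) desc by (simp add: S_def)
  let ?t = "2 * b\<^sup>2 * sqrt (S * ln n)" and ?r = "4 * (1 - b) * b\<^sup>2 * sqrt (S * ln n)"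
  have \<sigma>': "real S \<le> b ^ 6 * (4 * ln n * \<sigma>\<^sup>2)" using \<sigma> by (simp add: S_def)
  note par = swap_parameters[OF b c(1) n SL \<sigma>' \<kappa>(2,3) order_trans[OF one_le_numeral h(1)] h(2)]
  let ?A = "{u \<in> {1..n}. y u = col k}" and ?B = "{u \<in> {1..n}. y u = col (k - 1)}"
  have "?A = y -` {col k} \<inter> {1..n}" "?B = y -` {col (k - 1)} \<inter> {1..n}" by auto
  then have AB: "card ?A = s k" "card ?B = s (k - 1)"
    using y k by (auto simp: assignments_with_sizes_def color_count_def)
  have ne: "col k \<noteq> col (k - 1)" using inj_onD[OF inj, of k "k - 1"] k by fastforce
  have "\<kappa> \<le> c" using \<kappa>(2) b c by (smt (verit) mult_less_cancel_left2)
  then have "real h \<le> c * n" using h(2) by (smt (verit) mult_right_mono of_nat_0_le_iff)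
  then have hs: "h \<le> s k" "h \<le> s (k - 1)" using c(2) desc by linarith+
  let ?q = "\<lambda>x::real. exp (- (x + 1)\<^sup>2 / 2) / sqrt (2 * pi)"
  let ?G = "{\<omega> \<in> space M. \<exists>x\<in>assignments_with_sizes col k n s.
             ls_objective n (observation y \<sigma> W \<omega>) x < ls_objective n (observation y \<sigma> W \<omega>) y}"
  have "?G \<in> events" and G: "prob ?G \<ge> 1 - 2 * exp (- real h * ?q (?t / sqrt (2 * (S - 2 * h))))
          - real h ^ 2 * exp (- ?r\<^sup>2 / (16 * h))"
    using prob_better_swap_ge[OF M W y ne, of h ?t ?r \<sigma>] AB h(1) hs par(1,2) b l
    by (simp_all add: S_def)
  have q: "?q (b * sqrt (2 * ln n)) \<le> ?q (?t / sqrt (2 * (S - 2 * h)))"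
    using par(3) b l by (intro divide_right_mono) (auto intro!: power_mono)
  have "(\<kappa> * n - 1) * ?q (b * sqrt (2 * ln n)) \<le> real h * ?q (?t / sqrt (2 * (S - 2 * h)))"
    using h large q by (intro mult_mono) auto
  then have e1: "exp (- real h * ?q (?t / sqrt (2 * (S - 2 * h))))
      \<le> exp (- (\<kappa> * n - 1) * ?q (b * sqrt (2 * ln n)))" by (simp only: exp_le_cancel_iff mult_minus_left neg_le_iff_le)
  have "h \<le> n"
  proof -
    have "s k \<le> card {1..n}" unfolding AB(1)[symmetric] by (intro card_mono) auto
    then show ?thesis using hs by simp
  qed
  \<comment> \<open>There are at most \<open>n\<^sup>2\<close> pairs of candidates, each with a bad
    remainder with probability at most \<open>n powr (- 3)\<close>.\<close>
  have "real h ^ 2 * exp (- ?r\<^sup>2 / (16 * h)) \<le> real n ^ 2 * exp (- (3 * ln n))"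
    using \<open>h \<le> n\<close> par(4) by (intro mult_mono power_mono) auto
  also have "exp (- (3 * ln n)) = 1 / real n ^ 3"
    using n exp_of_nat_mult[of 3 "ln n"] by (simp add: exp_minus divide_inverse)
  also have "real n ^ 2 * (1 / real n ^ 3) = 1 / n" using n by (simp add: power2_eq_square power3_eq_cube)
  finally have e2: "real h ^ 2 * exp (- ?r\<^sup>2 / (16 * h)) \<le> 1 / n" .
  have yT: "y \<in> T" using y T by blast
  have "?G \<subseteq> {\<omega> \<in> space M. \<exists>x\<in>T.
      ls_objective n (observation y \<sigma> W \<omega>) x < ls_objective n (observation y \<sigma> W \<omega>) y}"
    using T(1) by blast
  also have "\<dots> \<subseteq> space M - {\<omega> \<in> space M. z \<omega> \<in> equiv_class col k n y}"
    using least_squares_estimator_events(3)[OF est T(2) yT] .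
  finally have "prob ?G \<le> prob (space M - {\<omega> \<in> space M. z \<omega> \<in> equiv_class col k n y})"
    using least_squares_estimator_events(1)[OF est T(2) yT] by (intro finite_measure_mono) auto
  also have "\<dots> = 1 - prob {\<omega> \<in> space M. z \<omega> \<in> equiv_class col k n y}"
    using least_squares_estimator_events(1)[OF est T(2) yT] by (rule prob_compl)
  finally show ?thesis using G e1 e2 by linarith
qed

section \<open>Passage to the limit for both estimators\<close>

theorem theorem2p2:
  fixes k :: nat
    and col :: "nat \<Rightarrow> real"
    and s :: "nat \<Rightarrow> nat \<Rightarrow> nat"
    and c :: real
    and y :: "nat \<Rightarrow> nat \<Rightarrow> real"
    and \<sigma> :: "nat \<Rightarrow> real"
    and M :: "nat \<Rightarrow> 'w measure"
    and W :: "nat \<Rightarrow> nat \<Rightarrow> nat \<Rightarrow> 'w \<Rightarrow> real"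
    and ytilde ybar :: "nat \<Rightarrow> 'w \<Rightarrow> nat \<Rightarrow> real"
  assumes "k \<ge> 2"
    and "inj_on col {1..k}"
    and "\<And>n i. n \<ge> k \<Longrightarrow> i \<in> {1..k} \<Longrightarrow> s n i > 0"
    and "\<And>n i j. n \<ge> k \<Longrightarrow> 1 \<le> i \<Longrightarrow> i \<le> j \<Longrightarrow> j \<le> k \<Longrightarrow> s n i \<ge> s n j"
    and "\<And>n. n \<ge> k \<Longrightarrow> (\<Sum>i=1..k. s n i) = n"
    and "c > 0"
    and "\<And>n. n \<ge> k \<Longrightarrow> real (s n k) \<ge> c * real n"
    and "\<And>n. n \<ge> k \<Longrightarrow> y n \<in> assignments_with_sizes col k n (s n)"
    and "\<And>n. n \<ge> k \<Longrightarrow> prob_space (M n)"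
    and "\<And>n. n \<ge> k \<Longrightarrow> std_gaussian_matrix (M n) n (W n)"
    and "\<And>n. n \<ge> k \<Longrightarrow>
           is_least_squares_estimator (M n) n (observation (y n) (\<sigma> n) (W n))
             (assignments_min_fraction col k n (2 * c / 3)) (ytilde n)"
    and "\<And>n. n \<ge> k \<Longrightarrow>
           is_least_squares_estimator (M n) n (observation (y n) (\<sigma> n) (W n))
             (assignments_with_sizes col k n (s n)) (ybar n)"
  shows
    "((\<exists>\<delta>>0. \<forall>n\<ge>k. (\<sigma> n)\<^sup>2 < (1 - \<delta>) * (real (s n k) + real (s n (k - 1))) / (4 * ln (real n))) \<longrightarrow>
        ((\<lambda>n. \<P>(\<omega> in M n. ytilde n \<omega> \<in> equiv_class col k n (y n))) \<longlonglongrightarrow> 1) \<and>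
        ((\<lambda>n. \<P>(\<omega> in M n. ybar n \<omega> \<in> equiv_class col k n (y n))) \<longlonglongrightarrow> 1)) \<and>
     ((\<exists>\<delta>>0. \<forall>n\<ge>k. (\<sigma> n)\<^sup>2 > (1 + \<delta>) * (real (s n k) + real (s n (k - 1))) / (4 * ln (real n))) \<longrightarrow>
        ((\<lambda>n. \<P>(\<omega> in M n. ytilde n \<omega> \<in> equiv_class col k n (y n))) \<longlonglongrightarrow> 0) \<and>
        ((\<lambda>n. \<P>(\<omega> in M n. ybar n \<omega> \<in> equiv_class col k n (y n))) \<longlonglongrightarrow> 0))"
proof -
  \<comment> \<open>Stated for arbitrary feasible sets \<open>T n\<close> and selections
    \<open>z n\<close>, so that both estimators are instances; likewise
    \<open>part2\<close>.\<close>
  have part1: "(\<lambda>n. \<P>(\<omega> in M n. z n \<omega> \<in> equiv_class col k n (y n))) \<longlonglongrightarrow> 1"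
    if \<delta>: "\<delta> > 0" "\<And>n. n \<ge> k \<Longrightarrow> (\<sigma> n)\<^sup>2 < (1 - \<delta>) * (real (s n k) + real (s n (k - 1))) / (4 * ln (real n))"
      and est: "\<And>n. n \<ge> k \<Longrightarrow> is_least_squares_estimator (M n) n (observation (y n) (\<sigma> n) (W n)) (T n) (z n)"
      and T: "\<And>n. n \<ge> k \<Longrightarrow> assignments_with_sizes col k n (s n) \<subseteq> T n" "\<And>n. n \<ge> k \<Longrightarrow> T n \<subseteq> assignments col k n"
    for \<delta> T z
  proof -
    let ?\<rho> = "\<lambda>n::nat. real k * real n powr (- \<delta> / 2)"
    let ?\<eta> = "min ((c / real k)\<^sup>2) (\<delta> * c * c / (real k)\<^sup>2)"
    let ?b = "\<lambda>n. ?\<rho> n / (1 - ?\<rho> n) + real k ^ n * exp (- (?\<eta> * n * ln n / 2))"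
    have k0: "real k > 0" and \<eta>0: "?\<eta> > 0" using assms(1,6) \<delta>(1) by auto
    have lim: "?b \<longlonglongrightarrow> 0" and \<rho>: "?\<rho> \<longlonglongrightarrow> 0"
      using union_bounds_tendsto_0[OF k0 \<delta>(1) \<eta>0] by auto
    have ev: "\<forall>\<^sub>F n in sequentially. n \<ge> k \<and> ?\<rho> n < 1"
      using eventually_ge_at_top[of k] order_tendstoD(2)[OF \<rho>, of 1] by (simp add: eventually_conj)
    show ?thesis
    proof (rule tendsto_sandwich)
      show "\<forall>\<^sub>F n in sequentially. 1 - ?b n \<le> \<P>(\<omega> in M n. z n \<omega> \<in> equiv_class col k n (y n))"
        using ev
      proof eventually_elim
        case (elim n)
        then have "y n \<in> T n" using assms(8) T(1) by blast
        then show ?case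
          using elim by (intro prob_recovery_ge[OF assms(1) _ assms(2) assms(4) assms(5) assms(6) assms(7)
              assms(8) assms(9) assms(10) \<delta>(1) \<delta>(2) est _ T(2)]) auto
      qed
      show "\<forall>\<^sub>F n in sequentially. \<P>(\<omega> in M n. z n \<omega> \<in> equiv_class col k n (y n)) \<le> 1"
        using eventually_ge_at_top[of k]
        by eventually_elim (simp add: assms(9) prob_space.prob_le_1)
      show "(\<lambda>n. 1 - ?b n) \<longlonglongrightarrow> 1" using tendsto_diff[OF tendsto_const lim, of 1] by simp
    qed simp
  qed
  have part2: "(\<lambda>n. \<P>(\<omega> in M n. z n \<omega> \<in> equiv_class col k n (y n))) \<longlonglongrightarrow> 0"
    if \<delta>: "\<delta> > 0" "\<And>n. n \<ge> k \<Longrightarrow> (\<sigma> n)\<^sup>2 > (1 + \<delta>) * (real (s n k) + real (s n (k - 1))) / (4 * ln (real n))"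
      and est: "\<And>n. n \<ge> k \<Longrightarrow> is_least_squares_estimator (M n) n (observation (y n) (\<sigma> n) (W n)) (T n) (z n)"
      and T: "\<And>n. n \<ge> k \<Longrightarrow> assignments_with_sizes col k n (s n) \<subseteq> T n" "\<And>n. n \<ge> k \<Longrightarrow> T n \<subseteq> assignments col k n"
    for \<delta> T z
  proof -
    \<comment> \<open>The sixth root turns the excess factor \<open>1 + \<delta>\<close> into the
      \<open>b ^ 6\<close> of \<open>swap_parameters\<close>.\<close>
    define b where "b = root 6 (1 / (1 + \<delta>))"
    have b6: "b ^ 6 * (1 + \<delta>) = 1" and b: "0 < b" "b < 1" using \<delta>(1) by (auto simp: b_def)
    define \<kappa> where "\<kappa> = min (c * (1 - b)) (2 / 3 * c * (1 - b)\<^sup>2 * b ^ 4)"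
    have \<kappa>: "0 < \<kappa>" "\<kappa> \<le> c * (1 - b)" "\<kappa> \<le> 2 / 3 * c * (1 - b)\<^sup>2 * b ^ 4"
      using b assms(6) by (auto simp: \<kappa>_def)
    have lim: "(\<lambda>n. 2 * exp (- (\<kappa> * n - 1) * (exp (- (b * sqrt (2 * ln n) + 1)\<^sup>2 / 2) / sqrt (2 * pi)))
           + 1 / real n) \<longlonglongrightarrow> 0"
      using b \<kappa>(1) by (rule swap_bound_tendsto_0)
    have "\<forall>\<^sub>F n in sequentially. 2 \<le> \<kappa> * real n" using \<kappa>(1) by real_asymp
    then have ev: "\<forall>\<^sub>F n in sequentially. n \<ge> k \<and> 2 \<le> \<kappa> * real n"
      using eventually_ge_at_top[of k] by (simp add: eventually_conj)
    show ?thesis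
    proof (rule tendsto_sandwich[OF _ _ tendsto_const lim])
      show "\<forall>\<^sub>F n in sequentially. \<P>(\<omega> in M n. z n \<omega> \<in> equiv_class col k n (y n))
        \<le> 2 * exp (- (\<kappa> * n - 1) * (exp (- (b * sqrt (2 * ln n) + 1)\<^sup>2 / 2) / sqrt (2 * pi))) + 1 / real n"
        using ev
      proof eventually_elim
        case (elim n)
        then have n: "n \<ge> k" and "n \<ge> 2" using assms(1) by auto
        then have "ln (real n) > 0" by simp
        then have "(1 + \<delta>) * (real (s n k) + real (s n (k - 1))) \<le> 4 * ln n * (\<sigma> n)\<^sup>2"
          using \<delta>(2)[OF n] by (simp add: pos_divide_less_eq mult.commute)
        then have "b ^ 6 * ((1 + \<delta>) * (real (s n k) + real (s n (k - 1)))) \<le> b ^ 6 * (4 * ln n * (\<sigma> n)\<^sup>2)"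
          using b by (intro mult_left_mono) auto
        then have "real (s n k) + real (s n (k - 1)) \<le> b ^ 6 * (4 * ln n * (\<sigma> n)\<^sup>2)"
          using b6 by (simp flip: mult.assoc)
        moreover have "s n (k - 1) \<ge> s n k" using assms(1,4) n by simp
        ultimately show ?case
          using prob_recovery_le[OF assms(1) n assms(2) _ assms(6) assms(7)[OF n] assms(8)[OF n]
              assms(9)[OF n] assms(10)[OF n] b _ \<kappa> est[OF n] T(1)[OF n] T(2)[OF n]] elim by blast
      qed
    qed simp
  qed
  \<comment> \<open>All true class sizes are at least \<open>c * n\<close>, hence above
    \<open>2 * c / 3 * n\<close>, so \<open>y n\<close> and all its swaps are feasible for
    \<open>ytilde\<close> as well.\<close>
  have T1: "assignments_with_sizes col k n (s n) \<subseteq> assignments_min_fraction col k n (2 * c / 3)" if "n \<ge> k" for n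
  proof (rule assignments_with_sizes_subset_min_fraction)
    show "k \<ge> 1" using assms(1) by simp
    fix i assume i: "i \<in> {1..k}"
    have "2 * c / 3 * real n \<le> c * real n" using assms(6) by simp
    also have "\<dots> \<le> s n k" using assms(7) that .
    also have "\<dots> \<le> s n i" using assms(4)[OF that, of i k] i by simp
    finally show "2 * c / 3 * real n \<le> s n i" .
  qed
  have T2: "assignments_min_fraction col k n (2 * c / 3) \<subseteq> assignments col k n"
    "assignments_with_sizes col k n (s n) \<subseteq> assignments col k n" for n
    by (auto simp: assignments_min_fraction_def assignments_with_sizes_def)
  show ?thesis
    using part1[OF _ _ assms(11) T1 T2(1)] part1[OF _ _ assms(12) subset_refl T2(2)]
      part2[OF _ _ assms(11) T1 T2(1)] part2[OF _ _ assms(12) subset_refl T2(2)] by blast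
qed

end
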